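(* Let $\xi$ be an ordinal with $0<\xi<\omega_1$. Then the class $\mathfrak{SM}_1^\xi$ and the class $\mathfrak{WC}^\xi$ both have the factorization property. That is: for every operator $A$ in $\mathfrak{SM}_1^\xi$ there exist a Banach space $Z$ whose identity $I_Z$ lies in $\mathfrak{SM}_1^\xi$ and operators $B,C$ with $A=BC$ factoring through $Z$; and likewise for every operator $A$ in $\mathfrak{WC}^\xi$ there is a Banach space $Z$ with $I_Z\in\mathfrak{WC}^\xi$ through which $A$ factors.
   Context: Operators are bounded linear maps between Banach spaces. Finite subsets of $\mathbb{N}$ are identified with strictly increasing finite sequences; for finite $E,F\subset\mathbb{N}$ write $E<F$ if $\max E<\min F$ or either is empty, and $n\leqslant E$ if $n\leqslant\min E$. Schreier families: $\mathcal{S}_0=\{E\subset\mathbb{N}:|E|\leqslant 1\}$; $\mathcal{S}_{\xi+1}=\{\bigcup_{i=1}^n E_i: n\in\mathbb{N}, n\leqslant E_1<\dots<E_n, \varnothing\neq E_i\in\mathcal{S}_\xi\}$; for a countable limit ordinal $\xi$, fix $\xi_n\uparrow\xi$ and set $\mathcal{S}_\xi=\{E:\exists n\leqslant E\in\mathcal{S}_{\xi_n}\}$. A bounded sequence $(x_n)$ in a Banach space is an $\ell_1^\xi$ spreading model if there is $K>0$ such that for every $E\in\mathcal{S}_\xi$ and scalars $(a_i)_{i\in E}$, $K^{-1}\sum_{i\in E}|a_i|\leqslant\|\sum_{i\in E}a_ix_i\|$. $\mathfrak{SM}_1^\xi$ is the class of operators $A:X\to Y$ such that for no $\ell_1^\xi$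 spreading model $(x_i)\subset X$ is $(Ax_i)$ an $\ell_1^\xi$ spreading model. $\mathfrak{WC}^\xi$ is the class of weakly compact operators lying in $\mathfrak{SM}_1^\xi$. *)

theory Defs
  imports "HOL-Analysis.Analysis"
begin

section \<open>Countable ordinals as Brouwer ordinal notations\<close>

datatype ordn = OZero | OSucc ordn | OLim "nat \<Rightarrow> ordn"

text \<open>Ordinal order on notations (Kraus, Nordvall Forsberg, Xu).\<close>
inductive ord_le :: "ordn \<Rightarrow> ordn \<Rightarrow> bool" where
  zero_le: "ord_le OZero y"
| succ_mono: "ord_le x y \<Longrightarrow> ord_le (OSucc x) (OSucc y)"
| le_lim: "ord_le x (f k) \<Longrightarrow> ord_le x (OLim f)"
| lim_le: "(\<forall>k. ord_le (f k) y) \<Longrightarrow> ord_le (OLim f) y"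

definition ord_less :: "ordn \<Rightarrow> ordn \<Rightarrow> bool" where
  "ord_less x y \<longleftrightarrow> ord_le (OSucc x) y"

text \<open>Well-formed notations: limit notations are given by strictly increasing
  sequences (xi_1 < xi_2 < ...); the limit notation denotes their supremum.\<close>
inductive ord_wf :: "ordn \<Rightarrow> bool" where
  "ord_wf OZero"
| "ord_wf x \<Longrightarrow> ord_wf (OSucc x)"
| "(\<forall>n. ord_wf (f n) \<and> ord_less (f n) (f (Suc n))) \<Longrightarrow> ord_wf (OLim f)"

section \<open>Schreier families (finite subsets of the positive integers)\<close>

text \<open>For a limit notation OLim f we use xi_(n+1) = f n, so the condition
  "n \<le> E" with n \<ge> 1 becomes "Suc n \<le> min E".\<close>
primrec schreier :: "ordn \<Rightarrow> nat set set" where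
  "schreier OZero = {E. finite E \<and> E \<subseteq> {1..} \<and> card E \<le> 1}"
| "schreier (OSucc x) =
     {E. \<exists>n::nat. \<exists>F::nat \<Rightarrow> nat set. 1 \<le> n \<and>
         (\<forall>i<n. F i \<noteq> {} \<and> F i \<in> schreier x) \<and>
         (\<forall>i. Suc i < n \<longrightarrow> Max (F i) < Min (F (Suc i))) \<and>
         n \<le> Min (F 0) \<and> E = (\<Union>i<n. F i)}"
| "schreier (OLim f) =
     {E. \<exists>n::nat. (E = {} \<or> Suc n \<le> Min E) \<and> E \<in> schreier (f n)}"

section \<open>Abstract real normed spaces on an explicit carrier\<close>

record 'a nspace =
  carrier :: "'a set"
  add :: "'a \<Rightarrow> 'a \<Rightarrow> 'a"
  scal :: "real \<Rightarrow> 'a \<Rightarrow> 'a"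
  zer :: "'a"
  nrm :: "'a \<Rightarrow> real"

definition banach_sp :: "'a nspace \<Rightarrow> bool" where
  "banach_sp Z \<longleftrightarrow>
     zer Z \<in> carrier Z \<and>
     (\<forall>x\<in>carrier Z. \<forall>y\<in>carrier Z. add Z x y \<in> carrier Z) \<and>
     (\<forall>a. \<forall>x\<in>carrier Z. scal Z a x \<in> carrier Z) \<and>
     (\<forall>x\<in>carrier Z. \<forall>y\<in>carrier Z. \<forall>z\<in>carrier Z. add Z (add Z x y) z = add Z x (add Z y z)) \<and>
     (\<forall>x\<in>carrier Z. \<forall>y\<in>carrier Z. add Z x y = add Z y x) \<and>
     (\<forall>x\<in>carrier Z. add Z x (zer Z) = x) \<and>
     (\<forall>x\<in>carrier Z. \<exists>y\<in>carrier Z. add Z x y = zer Z) \<and>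
     (\<forall>a. \<forall>x\<in>carrier Z. \<forall>y\<in>carrier Z. scal Z a (add Z x y) = add Z (scal Z a x) (scal Z a y)) \<and>
     (\<forall>a b. \<forall>x\<in>carrier Z. scal Z (a + b) x = add Z (scal Z a x) (scal Z b x)) \<and>
     (\<forall>a b. \<forall>x\<in>carrier Z. scal Z a (scal Z b x) = scal Z (a * b) x) \<and>
     (\<forall>x\<in>carrier Z. scal Z 1 x = x) \<and>
     (\<forall>x\<in>carrier Z. nrm Z x = 0 \<longleftrightarrow> x = zer Z) \<and>
     (\<forall>a. \<forall>x\<in>carrier Z. nrm Z (scal Z a x) = \<bar>a\<bar> * nrm Z x) \<and>
     (\<forall>x\<in>carrier Z. \<forall>y\<in>carrier Z. nrm Z (add Z x y) \<le> nrm Z x + nrm Z y) \<and>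
     (\<forall>s. (\<forall>n. s n \<in> carrier Z) \<longrightarrow>
          (\<forall>e>0. \<exists>N::nat. \<forall>m\<ge>N. \<forall>n\<ge>N. nrm Z (add Z (s m) (scal Z (-1) (s n))) < e) \<longrightarrow>
          (\<exists>l\<in>carrier Z. \<forall>e>0. \<exists>N::nat. \<forall>n\<ge>N. nrm Z (add Z (s n) (scal Z (-1) l)) < e))"

text \<open>A Banach space given by a type of class banach.\<close>
definition type_sp :: "'a::real_normed_vector nspace" where
  "type_sp = \<lparr>carrier = UNIV, add = (+), scal = (*\<^sub>R), zer = 0, nrm = norm\<rparr>"

text \<open>Operators = bounded linear maps.\<close>
definition operator :: "'a nspace \<Rightarrow> 'b nspace \<Rightarrow> ('a \<Rightarrow> 'b) \<Rightarrow> bool" where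
  "operator Z W T \<longleftrightarrow>
     (\<forall>x\<in>carrier Z. T x \<in> carrier W) \<and>
     (\<forall>x\<in>carrier Z. \<forall>y\<in>carrier Z. T (add Z x y) = add W (T x) (T y)) \<and>
     (\<forall>a. \<forall>x\<in>carrier Z. T (scal Z a x) = scal W a (T x)) \<and>
     (\<exists>K. \<forall>x\<in>carrier Z. nrm W (T x) \<le> K * nrm Z x)"

text \<open>Finite sums in an abstract space (in increasing order of the index).\<close>
definition nsum :: "'a nspace \<Rightarrow> nat set \<Rightarrow> (nat \<Rightarrow> 'a) \<Rightarrow> 'a" where
  "nsum Z E g = foldr (add Z) (map g (sorted_list_of_set E)) (zer Z)"

definition l1_spreading_model :: "ordn \<Rightarrow> 'a nspace \<Rightarrow> (nat \<Rightarrow> 'a) \<Rightarrow> bool" where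
  "l1_spreading_model \<xi> Z x \<longleftrightarrow>
     (\<forall>n. x n \<in> carrier Z) \<and> (\<exists>M. \<forall>n. nrm Z (x n) \<le> M) \<and>
     (\<exists>K>0. \<forall>E\<in>schreier \<xi>. \<forall>a::nat \<Rightarrow> real.
        (1 / K) * (\<Sum>i\<in>E. \<bar>a i\<bar>) \<le> nrm Z (nsum Z E (\<lambda>i. scal Z (a i) (x i))))"

text \<open>The class SM_1^xi.\<close>
definition SM1 :: "ordn \<Rightarrow> 'a nspace \<Rightarrow> 'b nspace \<Rightarrow> ('a \<Rightarrow> 'b) \<Rightarrow> bool" where
  "SM1 \<xi> Z W T \<longleftrightarrow> operator Z W T \<and>
     \<not> (\<exists>x. l1_spreading_model \<xi> Z x \<and> l1_spreading_model \<xi> W (T \<circ> x))"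

text \<open>Weak topology: the topology on the carrier generated by all bounded
  linear functionals.\<close>
definition weak_top :: "'a nspace \<Rightarrow> 'a topology" where
  "weak_top Z = topology_generated_by
     {carrier Z \<inter> \<phi> -` U | \<phi> U. operator Z (type_sp :: real nspace) \<phi> \<and> open U}"

definition weakly_compact_op :: "'a nspace \<Rightarrow> 'b nspace \<Rightarrow> ('a \<Rightarrow> 'b) \<Rightarrow> bool" where
  "weakly_compact_op Z W T \<longleftrightarrow> operator Z W T \<and>
     compactin (weak_top W) (weak_top W closure_of (T ` {x \<in> carrier Z. nrm Z x \<le> 1}))"

text \<open>The class WC^xi.\<close>
definition WC :: "ordn \<Rightarrow> 'a nspace \<Rightarrow> 'b nspace \<Rightarrow> ('a \<Rightarrow> 'b) \<Rightarrow> bool" where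
  "WC \<xi> Z W T \<longleftrightarrow> weakly_compact_op Z W T \<and> SM1 \<xi> Z W T"

end

theory Submission
  imports Defs
begin

text \<open>
  The space \<open>Z\<close> is the Davis--Figiel--Johnson--Pelczynski interpolation space of \<open>A\<close>: the l2 sum
  of the norms \<open>q n = K (2 ^ n)\<close>, where \<open>K t y = inf {|x| / t + t |y - A x|}\<close>. Each \<open>q n\<close> is
  equivalent to the norm of the target, \<open>A\<close> maps boundedly into the sum, and up to arbitrarily
  small balls the unit ball of the sum is contained in multiples of the image of the unit ball
  under \<open>A\<close>.

  Let \<open>(z i)\<close> be an l1-\<open>\<xi>\<close> spreading model for the norm of the sum. After passing to a
  subsequence, the sequences \<open>(q n (z i))\<close> have pairwise small inner products on a tail
  \<open>n \<ge> p\<close>, so on that tail the norm of the sum obeys an upper l2 estimate up to epsilon. Since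
  \<open>\<xi> > 0\<close>, averages over blocks of a fixed length \<open>m\<close> still span l1 on the sets of the Schreier
  family, and for \<open>m\<close> large the tail contributes little to them. So the first \<open>p\<close> coordinates,
  and hence the original norm, see the block averages as an l1-\<open>\<xi>\<close> spreading model.
  Approximating them by \<open>A x\<close> with bounded \<open>x\<close> contradicts the assumption on \<open>A\<close>.

  If \<open>A\<close> is weakly compact, every ultrafilter on the unit ball of the sum converges weakly in
  the target, by Grothendieck's criterion; the limit lies in that ball since its norm is a
  supremum of equivalent norms. By Mazur's lemma and the same subsequence estimate, the
  convergence is also weak in the sum.

  Every point of the sum is a limit of values of \<open>A\<close>, hence is coded by a sequence in the domain
  of \<open>A\<close>; transporting the structure along this coding realises \<open>Z\<close> on such sequences.
\<close>

section \<open>The Hahn--Banach theorem\<close>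

definition sublinear :: "('a::real_vector \<Rightarrow> real) \<Rightarrow> bool" where
  "sublinear p \<longleftrightarrow> (\<forall>x y. p (x + y) \<le> p x + p y) \<and> (\<forall>a x. 0 \<le> a \<longrightarrow> p (a *\<^sub>R x) = a * p x)"

definition seminorm :: "('a::real_vector \<Rightarrow> real) \<Rightarrow> bool" where
  "seminorm p \<longleftrightarrow> (\<forall>x y. p (x + y) \<le> p x + p y) \<and> (\<forall>a x. p (a *\<^sub>R x) = \<bar>a\<bar> * p x)"

lemma sublinear_add: "sublinear p \<Longrightarrow> p (x + y) \<le> p x + p y"
  and sublinear_scale: "sublinear p \<Longrightarrow> 0 \<le> a \<Longrightarrow> p (a *\<^sub>R x) = a * p x"
  unfolding sublinear_def by blast+

lemma sublinear_0: "sublinear p \<Longrightarrow> p 0 = 0"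
  using sublinear_scale[of p 0 0] by simp

lemma sublinear_minus_ge: "sublinear p \<Longrightarrow> - p (- x) \<le> p x"
  using sublinear_add[of p x "- x"] sublinear_0[of p] by simp

lemma sublinearI:
  assumes add: "\<And>x y. p (x + y) \<le> p x + p y"
    and scale: "\<And>a x. 0 < a \<Longrightarrow> p (a *\<^sub>R x) \<le> a * p x"
  shows "sublinear p"
proof -
  have "p 0 = 0"
    using scale[of 2 0] scale[of "1 / 2" 0] by simp
  moreover have "p (a *\<^sub>R x) = a * p x" if "0 < a" for a x
  proof (rule antisym)
    have "p x \<le> (1 / a) * p (a *\<^sub>R x)"
      using scale[of "1 / a" "a *\<^sub>R x"] that by simp
    then show "a * p x \<le> p (a *\<^sub>R x)" using that by (simp add: field_simps)
  qed (rule scale[OF that])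
  ultimately show ?thesis
    unfolding sublinear_def using add by (metis mult_zero_left order_le_less scaleR_zero_left)
qed

lemma seminorm_add: "seminorm p \<Longrightarrow> p (x + y) \<le> p x + p y"
  and seminorm_scale: "seminorm p \<Longrightarrow> p (a *\<^sub>R x) = \<bar>a\<bar> * p x"
  unfolding seminorm_def by blast+

lemma seminorm_imp_sublinear: "seminorm p \<Longrightarrow> sublinear p"
  by (simp add: seminorm_def sublinear_def)

lemma sublinear_even_imp_seminorm:
  assumes "sublinear p" "\<And>x. p (- x) = p x"
  shows "seminorm p"
proof -
  have "p (a *\<^sub>R x) = \<bar>a\<bar> * p x" for a x
    using sublinear_scale[OF assms(1), of "\<bar>a\<bar>" x] assms(2)[of "a *\<^sub>R x"] by (cases "0 \<le> a") auto
  then show ?thesis using sublinear_add[OF assms(1)] by (simp add: seminorm_def)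
qed

lemma seminorm_norm: "seminorm norm"
  by (simp add: seminorm_def norm_triangle_ineq)

lemma seminorm_minus: "seminorm p \<Longrightarrow> p (- x) = p x"
  using seminorm_scale[of p "-1" x] by simp

lemma seminorm_nonneg: "seminorm p \<Longrightarrow> 0 \<le> p x"
  using sublinear_minus_ge[OF seminorm_imp_sublinear, of p x] seminorm_minus[of p x] by linarith

lemma seminorm_sum_scaleR_le:
  assumes "seminorm p"
  shows "p (\<Sum>i\<in>F. a i *\<^sub>R z i) \<le> (\<Sum>i\<in>F. \<bar>a i\<bar> * p (z i))"
proof (induction F rule: infinite_finite_induct)
  case (insert i F)
  then show ?case
    using seminorm_add[OF assms, of "a i *\<^sub>R z i" "\<Sum>i\<in>F. a i *\<^sub>R z i"]
    by (simp add: seminorm_scale[OF assms])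
qed (simp_all add: sublinear_0 seminorm_imp_sublinear assms)

lemma le_cINF_add:
  fixes f :: "'i \<Rightarrow> real" and g :: "'j \<Rightarrow> real"
  assumes "I \<noteq> {}" "J \<noteq> {}" "\<And>i j. i \<in> I \<Longrightarrow> j \<in> J \<Longrightarrow> c \<le> f i + g j"
  shows "c \<le> (INF i\<in>I. f i) + (INF j\<in>J. g j)"
proof -
  have "c - (INF i\<in>I. f i) \<le> g j" if "j \<in> J" for j
  proof -
    have "c - g j \<le> (INF i\<in>I. f i)"
      by (rule cINF_greatest) (use assms that in \<open>auto simp: diff_le_eq\<close>)
    then show ?thesis by simp
  qed
  then have "c - (INF i\<in>I. f i) \<le> (INF j\<in>J. g j)"
    by (intro cINF_greatest) (use assms in auto)
  then show ?thesis by simp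
qed

lemma sublinear_INF:
  fixes h :: "'i \<Rightarrow> 'a::real_vector \<Rightarrow> real"
  assumes I: "I \<noteq> {}" and bdd: "\<And>x. bdd_below ((\<lambda>i. h i x) ` I)"
    and add: "\<And>i j x y. i \<in> I \<Longrightarrow> j \<in> I \<Longrightarrow> \<exists>k\<in>I. h k (x + y) \<le> h i x + h j y"
    and scale: "\<And>a i x. 0 < a \<Longrightarrow> i \<in> I \<Longrightarrow> \<exists>k\<in>I. h k (a *\<^sub>R x) \<le> a * h i x"
  shows "sublinear (\<lambda>x. INF i\<in>I. h i x)"
proof (rule sublinearI)
  have lower: "(INF i\<in>I. h i x) \<le> b" if "\<exists>k\<in>I. h k x \<le> b" for x b
    using cINF_lower2[OF bdd] that by blast
  show "(INF i\<in>I. h i (x + y)) \<le> (INF i\<in>I. h i x) + (INF i\<in>I. h i y)" for x y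
    by (intro le_cINF_add I lower add)
  show "(INF i\<in>I. h i (a *\<^sub>R x)) \<le> a * (INF i\<in>I. h i x)" if "0 < a" for a x
  proof -
    have "(INF i\<in>I. h i (a *\<^sub>R x)) / a \<le> (INF i\<in>I. h i x)"
    proof (rule cINF_greatest[OF I])
      fix i assume "i \<in> I"
      then show "(INF i\<in>I. h i (a *\<^sub>R x)) / a \<le> h i x"
        using lower[OF scale[OF that]] that by (simp add: field_simps)
    qed
    then show ?thesis using that by (simp add: field_simps)
  qed
qed

lemma convex_conic_combination:
  assumes "convex S" "s \<in> S" "s' \<in> S" "0 \<le> t" "0 \<le> t'"
  obtains r where "r \<in> S" "(t + t') *\<^sub>R r = t *\<^sub>R s + t' *\<^sub>R s'"
proof (cases "t + t' = 0")
  case True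
  then have "t = 0" "t' = 0" using assms by auto
  then show thesis using that[of s] assms by simp
next
  case False
  have "(t / (t + t')) *\<^sub>R s + (t' / (t + t')) *\<^sub>R s' \<in> S"
    using assms False by (intro convexD) (auto simp: add_divide_distrib[symmetric])
  then show thesis by (rule that) (use False in \<open>simp add: scaleR_add_right\<close>)
qed

text \<open>The largest sublinear functional below \<open>p\<close> that is at most \<open>- d\<close> on \<open>- S\<close>.\<close>

definition lowering :: "'a::real_vector set \<Rightarrow> real \<Rightarrow> ('a \<Rightarrow> real) \<Rightarrow> 'a \<Rightarrow> real" where
  "lowering S d p y = (INF (t, s)\<in>{0..} \<times> S. p (y + t *\<^sub>R s) - t * d)"

context
  fixes S :: "'a::real_vector set" and d :: real and p
  assumes p: "sublinear p" and d: "\<And>s. s \<in> S \<Longrightarrow> d \<le> p s"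
begin

lemma bdd_below_lowering: "bdd_below ((\<lambda>(t, s). p (y + t *\<^sub>R s) - t * d) ` ({0..} \<times> S))"
proof -
  have "- p (- y) \<le> p (y + t *\<^sub>R s) - t * d" if "0 \<le> t" "s \<in> S" for t s
  proof -
    have "t * d \<le> t * p s" using that d by (simp add: mult_left_mono)
    also have "\<dots> = p (t *\<^sub>R s)" using sublinear_scale[OF p] that by simp
    also have "\<dots> \<le> p (y + t *\<^sub>R s) + p (- y)"
      using sublinear_add[OF p, of "y + t *\<^sub>R s" "- y"] by simp
    finally show ?thesis by simp
  qed
  then show ?thesis by (intro bdd_belowI2[of _ "- p (- y)"]) auto
qed

lemma lowering_le: "0 \<le> t \<Longrightarrow> s \<in> S \<Longrightarrow> lowering S d p y \<le> p (y + t *\<^sub>R s) - t * d"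
  unfolding lowering_def using cINF_lower[OF bdd_below_lowering, of "(t, s)"] by simp

lemma sublinear_lowering:
  assumes S: "convex S" "S \<noteq> {}"
  shows "sublinear (lowering S d p)"
  unfolding lowering_def[abs_def]
proof (rule sublinear_INF[OF _ bdd_below_lowering])
  show "{0::real..} \<times> S \<noteq> {}" using S(2) by auto
next
  fix i j x y assume "i \<in> {0::real..} \<times> S" "j \<in> {0::real..} \<times> S"
  then obtain t s t' s' where i: "i = (t, s)" "0 \<le> t" "s \<in> S"
    and j: "j = (t', s')" "0 \<le> t'" "s' \<in> S"
    by auto
  obtain r where r: "r \<in> S" "(t + t') *\<^sub>R r = t *\<^sub>R s + t' *\<^sub>R s'"
    using convex_conic_combination[OF S(1) i(3) j(3) i(2) j(2)] by blast
  have "p (x + y + (t + t') *\<^sub>R r) - (t + t') * d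
      \<le> (p (x + t *\<^sub>R s) - t * d) + (p (y + t' *\<^sub>R s') - t' * d)"
    unfolding r(2)
    using sublinear_add[OF p, of "x + t *\<^sub>R s" "y + t' *\<^sub>R s'"] by (simp add: algebra_simps)
  then show "\<exists>k\<in>{0..} \<times> S. (case k of (t, s) \<Rightarrow> p (x + y + t *\<^sub>R s) - t * d)
      \<le> (case i of (t, s) \<Rightarrow> p (x + t *\<^sub>R s) - t * d) + (case j of (t, s) \<Rightarrow> p (y + t *\<^sub>R s) - t * d)"
    using i j r(1) by (intro bexI[of _ "(t + t', r)"]) auto
next
  fix a :: real and i x assume a: "0 < a" and "i \<in> {0::real..} \<times> S"
  then obtain t s where i: "i = (t, s)" "0 \<le> t" "s \<in> S" by auto
  have "p (a *\<^sub>R x + (a * t) *\<^sub>R s) - a * t * d = a * (p (x + t *\<^sub>R s) - t * d)"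
    using sublinear_scale[OF p, of a "x + t *\<^sub>R s"] a by (simp add: algebra_simps)
  then show "\<exists>k\<in>{0..} \<times> S. (case k of (t, s) \<Rightarrow> p (a *\<^sub>R x + t *\<^sub>R s) - t * d)
      \<le> a * (case i of (t, s) \<Rightarrow> p (x + t *\<^sub>R s) - t * d)"
    using i a by (intro bexI[of _ "(a * t, s)"]) auto
qed

lemma lowering_le_self: "S \<noteq> {} \<Longrightarrow> lowering S d p \<le> p"
  using lowering_le[of 0] by (fastforce simp: le_fun_def)

lemma lowering_minus_le: "s \<in> S \<Longrightarrow> lowering S d p (- s) \<le> - d"
  using lowering_le[of 1 s "- s"] sublinear_0[OF p] by simp

end

lemma Zorn_minimal:
  fixes A :: "'a::order set"
  assumes "\<And>C. C \<subseteq> A \<Longrightarrow> (\<And>x y. x \<in> C \<Longrightarrow> y \<in> C \<Longrightarrow> x \<le> y \<or> y \<le> x) \<Longrightarrow> \<exists>l\<in>A. \<forall>x\<in>C. l \<le> x"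
  obtains m where "m \<in> A" "\<And>x. x \<in> A \<Longrightarrow> x \<le> m \<Longrightarrow> x = m"
proof -
  have "\<exists>m\<in>A. \<forall>x\<in>A. m \<ge> x \<longrightarrow> x = m"
  proof (rule predicate_Zorn)
    show "partial_order_on A (relation_of (\<ge>) A)"
      by (rule partial_order_on_relation_ofI) auto
    show "\<exists>l\<in>A. \<forall>x\<in>C. x \<ge> l" if "C \<in> Chains (relation_of (\<ge>) A)" for C
      by (rule assms) (use that in \<open>auto simp: Chains_def relation_of_def\<close>)
  qed
  then show thesis using that by blast
qed

lemma sublinear_chain_INF:
  fixes p :: "'a::real_vector \<Rightarrow> real"
  assumes "C \<noteq> {}" and C: "\<And>f. f \<in> C \<Longrightarrow> sublinear f" "\<And>f. f \<in> C \<Longrightarrow> f \<le> p"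
    and chain: "\<And>f g. f \<in> C \<Longrightarrow> g \<in> C \<Longrightarrow> f \<le> g \<or> g \<le> f"
  shows "sublinear (\<lambda>x. INF f\<in>C. f x)" "\<And>f. f \<in> C \<Longrightarrow> (\<lambda>x. INF f\<in>C. f x) \<le> f"
proof -
  have "- p (- x) \<le> f x" if "f \<in> C" for f x
    using sublinear_minus_ge[OF C(1)[OF that], of x] le_funD[OF C(2)[OF that], of "- x"] by linarith
  then have bdd: "bdd_below ((\<lambda>f. f x) ` C)" for x by (rule bdd_belowI2)
  show "sublinear (\<lambda>x. INF f\<in>C. f x)"
  proof (rule sublinear_INF[OF \<open>C \<noteq> {}\<close> bdd])
    fix f g x y assume fg: "f \<in> C" "g \<in> C"
    then obtain k where k: "k \<in> C" "k \<le> f" "k \<le> g" using chain by blast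
    have "k (x + y) \<le> k x + k y" by (rule sublinear_add[OF C(1)[OF k(1)]])
    also have "\<dots> \<le> f x + g y" using k(2,3) by (intro add_mono) (auto dest: le_funD)
    finally show "\<exists>k\<in>C. k (x + y) \<le> f x + g y" using k(1) by blast
  qed (use C(1) sublinear_scale in \<open>metis less_imp_le order_refl\<close>)
  show "(\<lambda>x. INF f\<in>C. f x) \<le> f" if "f \<in> C" for f
    unfolding le_fun_def using cINF_lower[OF bdd that] by blast
qed

lemma ex_minimal_sublinear_le:
  fixes p :: "'a::real_vector \<Rightarrow> real"
  assumes "sublinear p"
  obtains m where "sublinear m" "m \<le> p" "\<And>f. sublinear f \<Longrightarrow> f \<le> m \<Longrightarrow> f = m"
proof -
  obtain m where "m \<in> {f. sublinear f \<and> f \<le> p}"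
    "\<And>f. f \<in> {f. sublinear f \<and> f \<le> p} \<Longrightarrow> f \<le> m \<Longrightarrow> f = m"
  proof (rule Zorn_minimal[of "{f. sublinear f \<and> f \<le> p}"])
    fix C assume C: "C \<subseteq> {f. sublinear f \<and> f \<le> p}"
      and chain: "\<And>f g. f \<in> C \<Longrightarrow> g \<in> C \<Longrightarrow> f \<le> g \<or> g \<le> f"
    show "\<exists>l\<in>{f. sublinear f \<and> f \<le> p}. \<forall>f\<in>C. l \<le> f"
    proof (cases "C = {}")
      case True
      then show ?thesis using assms by blast
    next
      case False
      define l where "l x = (INF f\<in>C. f x)" for x
      have l: "sublinear l" "\<And>f. f \<in> C \<Longrightarrow> l \<le> f"
        unfolding l_def using sublinear_chain_INF[OF False, of p] C chain by blast+
      moreover have "l \<le> p" using False C l(2) order_trans by blast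
      ultimately show ?thesis by blast
    qed
  qed blast
  then show thesis using that[of m] by (metis (mono_tags, lifting) mem_Collect_eq order_trans)
qed

lemma sublinear_odd_imp_linear:
  assumes p: "sublinear p" and odd: "\<And>x. p (- x) = - p x"
  shows "linear p"
proof (rule linearI)
  show "p (x + y) = p x + p y" for x y
    using sublinear_add[OF p, of x y] sublinear_add[OF p, of "- x" "- y"] odd[of "x + y"]
    by (simp add: odd)
  show "p (a *\<^sub>R x) = a *\<^sub>R p x" for a x
    using sublinear_scale[OF p, of a x] sublinear_scale[OF p, of "- a" x] odd[of "a *\<^sub>R x"]
    by (cases "0 \<le> a") auto
qed

text \<open>A minimal sublinear functional is odd, because it cannot be lowered at a single point.\<close>

theorem Hahn_Banach_sublinear:
  fixes p :: "'a::real_vector \<Rightarrow> real"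
  assumes "sublinear p"
  obtains f where "linear f" "f \<le> p"
proof -
  obtain m where m: "sublinear m" "m \<le> p" "\<And>f. sublinear f \<Longrightarrow> f \<le> m \<Longrightarrow> f = m"
    using ex_minimal_sublinear_le[OF assms] by blast
  have "m (- y) = - m y" for y
  proof -
    have "lowering {y} (m y) m = m"
      by (intro m(3) sublinear_lowering lowering_le_self m(1)) auto
    moreover have "lowering {y} (m y) m (- y) \<le> - m y" by (rule lowering_minus_le[OF m(1)]) auto
    ultimately show ?thesis using sublinear_minus_ge[OF m(1), of "- y"] by simp
  qed
  then show thesis using that sublinear_odd_imp_linear m(1,2) by blast
qed

corollary Hahn_Banach_convex:
  fixes p :: "'a::real_normed_vector \<Rightarrow> real"
  assumes p: "sublinear p" "\<And>x. p x \<le> B * norm x"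
    and S: "convex S" "S \<noteq> {}" "\<And>s. s \<in> S \<Longrightarrow> d \<le> p s"
  obtains \<phi> where "bounded_linear \<phi>" "\<And>x. \<phi> x \<le> p x" "\<And>s. s \<in> S \<Longrightarrow> d \<le> \<phi> s"
proof -
  obtain \<phi> where \<phi>: "linear \<phi>" "\<phi> \<le> lowering S d p"
    using Hahn_Banach_sublinear[OF sublinear_lowering[OF p(1) S(3,1,2)]] by blast
  have le: "\<phi> x \<le> p x" for x
    using \<phi>(2) lowering_le_self[OF p(1) S(3,2)] by (metis le_funD order_trans)
  have "norm (\<phi> x) \<le> norm x * B" for x
    using le[of x] le[of "- x"] p(2)[of x] p(2)[of "- x"] linear_neg[OF \<phi>(1), of x]
    by (simp add: abs_le_iff mult.commute)
  then have "bounded_linear \<phi>"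
    using \<phi>(1) by (intro bounded_linear_intro[of \<phi> B]) (auto simp: linear_add linear_cmul)
  moreover have "d \<le> \<phi> s" if "s \<in> S" for s
    using le_funD[OF \<phi>(2), of "- s"] lowering_minus_le[OF p(1) S(3) that] linear_neg[OF \<phi>(1), of s]
    by simp
  ultimately show thesis using that le by blast
qed

corollary ex_supporting_functional:
  fixes x :: "'a::real_normed_vector"
  assumes "sublinear p" "\<And>y. p y \<le> B * norm y"
  obtains \<phi> where "bounded_linear \<phi>" "\<And>y. \<phi> y \<le> p y" "\<phi> x = p x"
  using Hahn_Banach_convex[OF assms, of "{x}" "p x"] by (metis antisym convex_singleton insert_iff
      insert_not_empty empty_iff order_refl)

section \<open>Ultrafilters and compactness\<close>

definition ultrafilter :: "'a filter \<Rightarrow> bool" where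
  "ultrafilter F \<longleftrightarrow> F \<noteq> bot \<and> (\<forall>P. eventually P F \<or> eventually (\<lambda>x. \<not> P x) F)"

lemma ultrafilter_not_bot: "ultrafilter F \<Longrightarrow> F \<noteq> bot"
  by (simp add: ultrafilter_def)

lemma ultrafilter_not_eventually: "ultrafilter F \<Longrightarrow> \<not> eventually P F \<Longrightarrow> eventually (\<lambda>x. \<not> P x) F"
  unfolding ultrafilter_def by blast

lemma minimal_imp_ultrafilter:
  assumes "U \<noteq> bot" and minimal: "\<And>G. G \<noteq> bot \<Longrightarrow> G \<le> U \<Longrightarrow> G = U"
  shows "ultrafilter U"
  unfolding ultrafilter_def
proof (intro conjI allI)
  fix P
  show "eventually P U \<or> eventually (\<lambda>x. \<not> P x) U"
  proof (cases "inf U (principal {x. P x}) = bot")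
    case True
    then have "eventually (\<lambda>_. False) (inf U (principal {x. P x}))" by simp
    then show ?thesis by (simp add: eventually_inf_principal)
  next
    case False
    then have "inf U (principal {x. P x}) = U" by (intro minimal) auto
    then have "U \<le> principal {x. P x}" by (metis inf.cobounded2)
    then show ?thesis by (simp add: le_principal)
  qed
qed fact

lemma Inf_filter_chain_not_bot:
  fixes C :: "'a filter set"
  assumes "C \<noteq> {}" "\<And>G. G \<in> C \<Longrightarrow> G \<noteq> bot"
    and chain: "\<And>G H. G \<in> C \<Longrightarrow> H \<in> C \<Longrightarrow> G \<le> H \<or> H \<le> G"
  shows "Inf C \<noteq> bot"
proof
  assume "Inf C = bot"
  then have "eventually (\<lambda>_. False) (Inf C)" by simp
  then obtain G where "G \<in> C" "eventually (\<lambda>_. False) G"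
    using eventually_Inf_base[OF assms(1), of "\<lambda>_. False"] chain
    by (metis inf.absorb1 inf.absorb2 order_refl)
  then show False using assms(2) by (auto simp: trivial_limit_def)
qed

lemma ex_ultrafilter_le:
  fixes F :: "'a filter"
  assumes "F \<noteq> bot"
  obtains U where "ultrafilter U" "U \<le> F"
proof -
  obtain U where U: "U \<in> {G. G \<noteq> bot \<and> G \<le> F}"
    and minimal: "\<And>G. G \<in> {G. G \<noteq> bot \<and> G \<le> F} \<Longrightarrow> G \<le> U \<Longrightarrow> G = U"
  proof (rule Zorn_minimal[of "{G. G \<noteq> bot \<and> G \<le> F}"])
    fix C assume C: "C \<subseteq> {G. G \<noteq> bot \<and> G \<le> F}"
      and chain: "\<And>G H. G \<in> C \<Longrightarrow> H \<in> C \<Longrightarrow> G \<le> H \<or> H \<le> G"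
    show "\<exists>L\<in>{G. G \<noteq> bot \<and> G \<le> F}. \<forall>G\<in>C. L \<le> G"
    proof (cases "C = {}")
      case True
      then show ?thesis using assms by blast
    next
      case False
      then have "Inf C \<noteq> bot" using C chain by (intro Inf_filter_chain_not_bot) auto
      moreover have "Inf C \<le> F" using False C by (blast intro: Inf_lower2)
      ultimately show ?thesis by (intro bexI[of _ "Inf C"]) (auto intro: Inf_lower)
    qed
  qed blast
  have "ultrafilter U"
    by (rule minimal_imp_ultrafilter) (use U minimal in auto)
  then show thesis using that U by blast
qed

lemma compactin_imp_ultrafilter_limit:
  assumes S: "compactin X S" and F: "ultrafilter F" "eventually (\<lambda>x. f x \<in> S) F"
  obtains l where "l \<in> S" "limitin X f l F"
proof -
  define \<C> where "\<C> = {C. closedin X C \<and> eventually (\<lambda>x. f x \<in> C) F}"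
  have "S \<inter> \<Inter>\<F> \<noteq> {}" if "finite \<F>" "\<F> \<subseteq> \<C>" for \<F>
  proof -
    have "eventually (\<lambda>x. \<forall>C\<in>\<F>. f x \<in> C) F"
      using that by (auto simp: eventually_ball_finite_distrib \<C>_def)
    with F(2) have "eventually (\<lambda>x. f x \<in> S \<inter> \<Inter>\<F>) F" by eventually_elim blast
    then show ?thesis using eventually_happens'[OF ultrafilter_not_bot[OF F(1)]] by blast
  qed
  moreover have "\<forall>C\<in>\<C>. closedin X C" by (simp add: \<C>_def)
  ultimately have "S \<inter> \<Inter>\<C> \<noteq> {}" using S unfolding compactin_fip by blast
  then obtain l where l: "l \<in> S" "\<And>C. C \<in> \<C> \<Longrightarrow> l \<in> C" by blast
  have "eventually (\<lambda>x. f x \<in> V) F" if V: "openin X V" "l \<in> V" for V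
  proof (rule ccontr)
    assume "\<not> ?thesis"
    then have "eventually (\<lambda>x. f x \<notin> V) F" by (rule ultrafilter_not_eventually[OF F(1)])
    with F(2) have "eventually (\<lambda>x. f x \<in> topspace X - V) F"
      by eventually_elim (use compactin_subset_topspace[OF S] in auto)
    then have "topspace X - V \<in> \<C>" using V(1) by (simp add: \<C>_def closedin_diff)
    then show False using l(2) V(2) by blast
  qed
  then have "limitin X f l F"
    using l(1) compactin_subset_topspace[OF S] by (auto simp: limitin_def)
  then show thesis using that l(1) by blast
qed

lemma compactin_ultrafilterI:
  assumes "S \<subseteq> topspace X"
    and lim: "\<And>F. ultrafilter F \<Longrightarrow> eventually (\<lambda>x. x \<in> S) F \<Longrightarrow> \<exists>l\<in>S. limitin X (\<lambda>x. x) l F"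
  shows "compactin X S"
  unfolding compactin_fip
proof (intro conjI allI impI assms(1))
  fix \<C> assume \<C>: "(\<forall>C\<in>\<C>. closedin X C) \<and> (\<forall>\<F>. finite \<F> \<and> \<F> \<subseteq> \<C> \<longrightarrow> S \<inter> \<Inter>\<F> \<noteq> {})"
  define G where "G = (INF C\<in>insert UNIV \<C>. principal (S \<inter> C))"
  have "G \<noteq> bot"
    unfolding G_def
  proof (rule INF_filter_not_bot)
    fix \<F> assume "\<F> \<subseteq> insert UNIV \<C>" "finite \<F>"
    then have "S \<inter> \<Inter>(\<F> - {UNIV}) \<noteq> {}"
      using conjunct2[OF \<C>, rule_format, of "\<F> - {UNIV}"] by blast
    then obtain x where "x \<in> S" "\<forall>C\<in>\<F>. x \<in> C" by blast
    then have "principal {x} \<le> (INF C\<in>\<F>. principal (S \<inter> C))" by (intro INF_greatest) auto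
    then show "(INF C\<in>\<F>. principal (S \<inter> C)) \<noteq> bot"
      by (metis bot.extremum_uniqueI insert_not_empty principal_eq_bot_iff)
  qed
  then obtain F where F: "ultrafilter F" "F \<le> G" by (rule ex_ultrafilter_le)
  have ev: "eventually (\<lambda>x. x \<in> S \<inter> C) F" if "C \<in> insert UNIV \<C>" for C
    using F(2) that unfolding G_def le_INF_iff by (blast intro: le_principal[THEN iffD1])
  then obtain l where l: "l \<in> S" "limitin X (\<lambda>x. x) l F"
    using lim[OF F(1)] ev[of UNIV] by auto
  have "l \<in> C" if "C \<in> \<C>" for C
    by (rule limitin_closedin[OF l(2)])
      (use \<C> that ev[of C] ultrafilter_not_bot[OF F(1)] in \<open>auto elim: eventually_mono\<close>)
  then show "S \<inter> \<Inter>\<C> \<noteq> {}" using l(1) by blast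
qed

lemma ultrafilter_bounded_tendsto:
  fixes f :: "'a \<Rightarrow> real"
  assumes "ultrafilter F" "\<And>x. a \<le> f x" "\<And>x. f x \<le> b"
  obtains l where "(f \<longlongrightarrow> l) F"
proof (rule compactin_imp_ultrafilter_limit[OF _ assms(1)])
  show "compactin euclidean {a..b}" by simp
  show "eventually (\<lambda>x. f x \<in> {a..b}) F" using assms(2,3) by simp
qed simp

section \<open>Banach spaces on a carrier set\<close>

definition normed_subspace :: "'a::real_vector set \<Rightarrow> ('a \<Rightarrow> real) \<Rightarrow> 'a nspace" where
  "normed_subspace S p = \<lparr>carrier = S, add = (+), scal = (*\<^sub>R), zer = 0, nrm = p\<rparr>"

lemma normed_subspace_simps [simp]:
  "carrier (normed_subspace S p) = S" "add (normed_subspace S p) = (+)"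
  "scal (normed_subspace S p) = (*\<^sub>R)" "zer (normed_subspace S p) = 0"
  "nrm (normed_subspace S p) = p"
  by (simp_all add: normed_subspace_def)

lemma type_sp_eq_normed_subspace: "type_sp = normed_subspace UNIV norm"
  by (simp add: type_sp_def normed_subspace_def)

lemma type_sp_simps [simp]:
  "carrier type_sp = UNIV" "add type_sp = (+)" "scal type_sp = (*\<^sub>R)" "zer type_sp = 0"
  "nrm type_sp = norm"
  by (simp_all add: type_sp_eq_normed_subspace)

lemma banach_sp_normed_subspace:
  assumes S: "subspace S"
    and add: "\<And>x y. x \<in> S \<Longrightarrow> y \<in> S \<Longrightarrow> p (x + y) \<le> p x + p y"
    and scale: "\<And>a x. x \<in> S \<Longrightarrow> p (a *\<^sub>R x) = \<bar>a\<bar> * p x"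
    and eq_0: "\<And>x. x \<in> S \<Longrightarrow> p x = 0 \<Longrightarrow> x = 0"
    and complete: "\<And>s :: nat \<Rightarrow> 'a::real_vector. (\<And>n. s n \<in> S) \<Longrightarrow>
      (\<And>e. 0 < e \<Longrightarrow> \<exists>N. \<forall>m\<ge>N. \<forall>n\<ge>N. p (s m - s n) < e) \<Longrightarrow>
      \<exists>l\<in>S. \<forall>e>0. \<exists>N. \<forall>n\<ge>N. p (s n - l) < e"
  shows "banach_sp (normed_subspace S p)"
proof -
  have "\<exists>y\<in>S. x + y = 0" if "x \<in> S" for x
    using subspace_neg[OF S that] by (metis add.right_inverse)
  moreover have "p x = 0 \<longleftrightarrow> x = 0" if "x \<in> S" for x
    using eq_0[OF that] scale[OF that, of 0] by auto
  ultimately show ?thesis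
    unfolding banach_sp_def
    using complete by (auto simp: add scale subspace_0[OF S] subspace_add[OF S] subspace_scale[OF S]
        add.assoc add.commute scaleR_add_right scaleR_add_left)
qed

lemma banach_sp_type_sp: "banach_sp (type_sp :: 'a::banach nspace)"
  unfolding type_sp_eq_normed_subspace
proof (rule banach_sp_normed_subspace)
  fix s :: "nat \<Rightarrow> 'a"
  assume "\<And>e. 0 < e \<Longrightarrow> \<exists>N. \<forall>m\<ge>N. \<forall>n\<ge>N. norm (s m - s n) < e"
  then obtain l where "s \<longlonglongrightarrow> l" by (metis CauchyI Cauchy_convergent convergent_def)
  then show "\<exists>l\<in>UNIV. \<forall>e>0. \<exists>N. \<forall>n\<ge>N. norm (s n - l) < e" by (auto dest: LIMSEQ_D)
qed (simp_all add: norm_triangle_ineq)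

context
  fixes Z :: "'a nspace"
  assumes Z: "banach_sp Z"
begin

lemma
  shows banach_sp_zer_closed: "zer Z \<in> carrier Z"
    and banach_sp_add_closed: "x \<in> carrier Z \<Longrightarrow> y \<in> carrier Z \<Longrightarrow> add Z x y \<in> carrier Z"
    and banach_sp_scal_closed: "x \<in> carrier Z \<Longrightarrow> scal Z a x \<in> carrier Z"
    and banach_sp_add_assoc: "x \<in> carrier Z \<Longrightarrow> y \<in> carrier Z \<Longrightarrow> z \<in> carrier Z \<Longrightarrow>
      add Z (add Z x y) z = add Z x (add Z y z)"
    and banach_sp_add_commute: "x \<in> carrier Z \<Longrightarrow> y \<in> carrier Z \<Longrightarrow> add Z x y = add Z y x"
    and banach_sp_add_zer: "x \<in> carrier Z \<Longrightarrow> add Z x (zer Z) = x"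
    and banach_sp_add_inverse: "x \<in> carrier Z \<Longrightarrow> \<exists>y\<in>carrier Z. add Z x y = zer Z"
    and banach_sp_scal_add_right: "x \<in> carrier Z \<Longrightarrow> y \<in> carrier Z \<Longrightarrow>
      scal Z a (add Z x y) = add Z (scal Z a x) (scal Z a y)"
    and banach_sp_scal_add_left: "x \<in> carrier Z \<Longrightarrow>
      scal Z (a + b) x = add Z (scal Z a x) (scal Z b x)"
    and banach_sp_scal_scal: "x \<in> carrier Z \<Longrightarrow> scal Z a (scal Z b x) = scal Z (a * b) x"
    and banach_sp_scal_one: "x \<in> carrier Z \<Longrightarrow> scal Z 1 x = x"
    and banach_sp_nrm_eq_0: "x \<in> carrier Z \<Longrightarrow> nrm Z x = 0 \<longleftrightarrow> x = zer Z"
    and banach_sp_nrm_scal: "x \<in> carrier Z \<Longrightarrow> nrm Z (scal Z a x) = \<bar>a\<bar> * nrm Z x"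
    and banach_sp_nrm_triangle: "x \<in> carrier Z \<Longrightarrow> y \<in> carrier Z \<Longrightarrow>
      nrm Z (add Z x y) \<le> nrm Z x + nrm Z y"
  using Z unfolding banach_sp_def by - (elim conjE, metis)+

lemma banach_sp_complete:
  assumes "\<And>n. s n \<in> carrier Z"
    and "\<And>e. 0 < e \<Longrightarrow> \<exists>N::nat. \<forall>m\<ge>N. \<forall>n\<ge>N. nrm Z (add Z (s m) (scal Z (- 1) (s n))) < e"
  shows "\<exists>l\<in>carrier Z. \<forall>e>0. \<exists>N::nat. \<forall>n\<ge>N. nrm Z (add Z (s n) (scal Z (- 1) l)) < e"
  using assms Z by (simp add: banach_sp_def)

lemma banach_sp_scal_0: "x \<in> carrier Z \<Longrightarrow> scal Z 0 x = zer Z"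
  by (simp flip: banach_sp_nrm_eq_0 add: banach_sp_scal_closed banach_sp_nrm_scal)

lemma banach_sp_nrm_nonneg: "x \<in> carrier Z \<Longrightarrow> 0 \<le> nrm Z x"
proof -
  assume x: "x \<in> carrier Z"
  have "0 = nrm Z (scal Z (1 + - 1) x)"
    using x by (simp add: banach_sp_scal_0 banach_sp_nrm_eq_0 banach_sp_zer_closed)
  also have "\<dots> \<le> nrm Z (scal Z 1 x) + nrm Z (scal Z (- 1) x)"
    unfolding banach_sp_scal_add_left[OF x]
    by (intro banach_sp_nrm_triangle banach_sp_scal_closed x)
  also have "\<dots> = 2 * nrm Z x" by (simp add: banach_sp_nrm_scal[OF x])
  finally show ?thesis by simp
qed

lemma foldr_add_closed:
  "(\<And>i. g i \<in> carrier Z) \<Longrightarrow> foldr (add Z) (map g ks) (zer Z) \<in> carrier Z"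
  by (induction ks) (simp_all add: banach_sp_zer_closed banach_sp_add_closed)

lemma nsum_closed: "(\<And>i. g i \<in> carrier Z) \<Longrightarrow> nsum Z E g \<in> carrier Z"
  by (simp add: nsum_def foldr_add_closed)

end

lemma operator_comp:
  assumes "operator Z W S" "operator W V T" and W: "banach_sp W"
  shows "operator Z V (T \<circ> S)"
proof -
  obtain K where K: "\<forall>x\<in>carrier Z. nrm W (S x) \<le> K * nrm Z x"
    using assms(1) by (auto simp: operator_def)
  obtain L where L: "\<forall>x\<in>carrier W. nrm V (T x) \<le> L * nrm W x"
    using assms(2) by (auto simp: operator_def)
  have S: "S x \<in> carrier W" if "x \<in> carrier Z" for x
    using assms(1) that by (simp add: operator_def)
  have "nrm V (T (S x)) \<le> \<bar>L\<bar> * K * nrm Z x" if "x \<in> carrier Z" for x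
  proof -
    have "nrm V (T (S x)) \<le> L * nrm W (S x)" using L S that by blast
    also have "\<dots> \<le> \<bar>L\<bar> * nrm W (S x)"
      by (intro mult_right_mono banach_sp_nrm_nonneg[OF W] S that) simp
    also have "\<dots> \<le> \<bar>L\<bar> * (K * nrm Z x)" using K that by (intro mult_left_mono) auto
    finally show ?thesis by (simp add: mult.assoc)
  qed
  then have "\<exists>K. \<forall>x\<in>carrier Z. nrm V (T (S x)) \<le> K * nrm Z x" by blast
  then show ?thesis using assms(1,2) by (simp add: operator_def)
qed

lemma operator_id: "operator Z Z id"
  unfolding operator_def by (auto intro: exI[of _ 1])

lemma operator_type_sp_iff: "operator type_sp type_sp T \<longleftrightarrow> bounded_linear T"
proof
  assume "operator type_sp type_sp T"
  then obtain K where "\<And>x. norm (T x) \<le> K * norm x" and "\<And>x y. T (x + y) = T x + T y"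
    "\<And>a x. T (a *\<^sub>R x) = a *\<^sub>R T x"
    unfolding operator_def by auto
  then show "bounded_linear T" by (intro bounded_linear_intro[of T K]) (auto simp: mult.commute)
next
  assume "bounded_linear T"
  then interpret bounded_linear T .
  show "operator type_sp type_sp T"
    unfolding operator_def using bounded by (auto simp: add scale mult.commute)
qed

lemma operator_nsum:
  assumes T: "operator Z W T" and Z: "banach_sp Z" and W: "banach_sp W" and g: "\<And>i. g i \<in> carrier Z"
  shows "T (nsum Z E g) = nsum W E (\<lambda>i. T (g i))"
proof -
  have "T (zer Z) = T (scal Z 0 (zer Z))"
    by (simp add: banach_sp_scal_0[OF Z] banach_sp_zer_closed[OF Z])
  also have "\<dots> = zer W"
    using T banach_sp_zer_closed[OF Z] by (simp add: operator_def banach_sp_scal_0[OF W])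
  finally have zer: "T (zer Z) = zer W" .
  have "T (foldr (add Z) (map g ks) (zer Z)) = foldr (add W) (map (\<lambda>i. T (g i)) ks) (zer W)" for ks
    using T by (induction ks) (simp_all add: zer foldr_add_closed[OF Z] g operator_def)
  then show ?thesis by (simp add: nsum_def)
qed

lemma nsum_normed_subspace:
  assumes "finite E"
  shows "nsum (normed_subspace S p) E g = sum g E"
proof -
  have "foldr (+) (map g ks) 0 = sum g (set ks)" if "distinct ks" for ks
    using that by (induction ks) auto
  from this[of "sorted_list_of_set E"] show ?thesis using assms by (simp add: nsum_def)
qed

lemma operator_normed_subspace_diff:
  assumes S: "subspace S" and \<phi>: "operator (normed_subspace S p) type_sp \<phi>" and "x \<in> S" "y \<in> S"
  shows "\<phi> (x - y) = \<phi> x - \<phi> y"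
proof -
  have "\<phi> (x + (-1) *\<^sub>R y) = \<phi> x + \<phi> ((-1) *\<^sub>R y)"
    using \<phi> assms(3,4) subspace_scale[OF S]
    by (simp only: operator_def normed_subspace_simps type_sp_simps)
  also have "\<phi> ((-1) *\<^sub>R y) = (-1) *\<^sub>R \<phi> y"
    using \<phi> assms(4) by (simp only: operator_def normed_subspace_simps type_sp_simps)
  finally show ?thesis by simp
qed

lemma convex_superlevel_operator:
  assumes S: "subspace S" and \<phi>: "operator (normed_subspace S p) (type_sp :: real nspace) \<phi>"
  shows "convex {y \<in> S. b \<le> \<phi> y}"
proof (rule convexI)
  fix x y and s t :: real
  assume xy: "x \<in> {y \<in> S. b \<le> \<phi> y}" "y \<in> {y \<in> S. b \<le> \<phi> y}" and st: "0 \<le> s" "0 \<le> t" "s + t = 1"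
  have "b = s * b + t * b" using st by (simp flip: distrib_right)
  also have "\<dots> \<le> s * \<phi> x + t * \<phi> y" using xy st by (intro add_mono mult_left_mono) auto
  also have "\<dots> = \<phi> (s *\<^sub>R x + t *\<^sub>R y)"
    using \<phi> xy by (simp add: operator_def subspace_scale[OF S])
  finally show "s *\<^sub>R x + t *\<^sub>R y \<in> {y \<in> S. b \<le> \<phi> y}"
    using xy by (simp add: subspace_add[OF S] subspace_scale[OF S])
qed

section \<open>The weak topology\<close>

lemma topspace_weak_top: "topspace (weak_top W) = carrier W"
proof -
  have "operator W (type_sp :: real nspace) (\<lambda>_. 0)"
    unfolding operator_def by (auto intro: exI[of _ 0])
  moreover have "carrier W = carrier W \<inter> (\<lambda>_. 0::real) -` UNIV" by simp
  ultimately show ?thesis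
    unfolding weak_top_def topology_generated_by_topspace by (fastforce intro: exI[of _ "UNIV"])
qed

lemma openin_weak_top_vimage:
  "operator W (type_sp :: real nspace) \<phi> \<Longrightarrow> open U \<Longrightarrow> openin (weak_top W) (carrier W \<inter> \<phi> -` U)"
  unfolding weak_top_def by (rule topology_generated_by_Basis) blast

lemma limitin_weak_topD:
  assumes "limitin (weak_top W) f l F" "operator W (type_sp :: real nspace) \<phi>"
  shows "((\<lambda>x. \<phi> (f x)) \<longlongrightarrow> \<phi> l) F"
proof (rule topological_tendstoI)
  fix U :: "real set" assume "open U" "\<phi> l \<in> U"
  then have "eventually (\<lambda>x. f x \<in> carrier W \<inter> \<phi> -` U) F"
    using limitinD[OF assms(1) openin_weak_top_vimage[OF assms(2)]] limitin_topspace[OF assms(1)]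
    by (simp add: topspace_weak_top)
  then show "eventually (\<lambda>x. \<phi> (f x) \<in> U) F" by eventually_elim simp
qed

lemma limitin_weak_topI:
  assumes l: "l \<in> carrier W" and f: "eventually (\<lambda>x. f x \<in> carrier W) F"
    and lim: "\<And>\<phi>. operator W (type_sp :: real nspace) \<phi> \<Longrightarrow> ((\<lambda>x. \<phi> (f x)) \<longlongrightarrow> \<phi> l) F"
  shows "limitin (weak_top W) f l F"
  unfolding limitin_def topspace_weak_top
proof (intro conjI allI impI l; elim conjE)
  fix V assume "openin (weak_top W) V" "l \<in> V"
  then have "generate_topology_on
      {carrier W \<inter> \<phi> -` U | \<phi> U. operator W (type_sp :: real nspace) \<phi> \<and> open U} V"
    unfolding weak_top_def by (intro openin_topology_generated_by)
  then show "eventually (\<lambda>x. f x \<in> V) F" using \<open>l \<in> V\<close>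
  proof induction
    case (Int a b)
    then show ?case by (auto elim: eventually_elim2)
  next
    case (UN K)
    then obtain k where "k \<in> K" "l \<in> k" by blast
    then show ?case using UN.IH[of k] by (auto elim: eventually_mono)
  next
    case (Basis V)
    then obtain \<phi> U where V: "V = carrier W \<inter> \<phi> -` U" and \<phi>: "operator W (type_sp :: real nspace) \<phi>"
      and "open U" by blast
    then have "eventually (\<lambda>x. \<phi> (f x) \<in> U) F"
      using topological_tendstoD[OF lim[OF \<phi>]] Basis by simp
    then show ?case using f by eventually_elim (simp add: V)
  qed simp
qed

lemma continuous_map_weak_top:
  assumes T: "operator Z W T" and W: "banach_sp W"
  shows "continuous_map (weak_top Z) (weak_top W) T"
  unfolding weak_top_def[of W]
proof (rule continuous_on_generated_topo)
  fix V assume "V \<in> {carrier W \<inter> \<phi> -` U | \<phi> U. operator W (type_sp :: real nspace) \<phi> \<and> open U}"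
  then obtain \<phi> U where V: "V = carrier W \<inter> \<phi> -` U" and \<phi>: "operator W (type_sp :: real nspace) \<phi>"
    and U: "open U" by blast
  have "T -` V \<inter> topspace (weak_top Z) = carrier Z \<inter> (\<phi> \<circ> T) -` U"
    using T by (auto simp: V topspace_weak_top operator_def)
  then show "openin (weak_top Z) (T -` V \<inter> topspace (weak_top Z))"
    using openin_weak_top_vimage[OF operator_comp[OF T \<phi> W] U] by simp
next
  have "T ` carrier Z \<subseteq> carrier W" using T by (auto simp: operator_def)
  then show "T ` topspace (weak_top Z)
      \<subseteq> \<Union> {carrier W \<inter> \<phi> -` U | \<phi> U. operator W (type_sp :: real nspace) \<phi> \<and> open U}"
    unfolding topspace_weak_top
    using topspace_weak_top[of W] by (simp add: weak_top_def topology_generated_by_topspace)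
qed

section \<open>Transport of structure\<close>

definition transport :: "('a \<Rightarrow> 'b) \<Rightarrow> 'a nspace \<Rightarrow> 'b nspace" where
  "transport f W = (let g = the_inv_into (carrier W) f in
    \<lparr>carrier = f ` carrier W, add = \<lambda>s t. f (add W (g s) (g t)), scal = \<lambda>a s. f (scal W a (g s)),
     zer = f (zer W), nrm = \<lambda>s. nrm W (g s)\<rparr>)"

context
  fixes f :: "'a \<Rightarrow> 'b" and W :: "'a nspace"
  assumes f: "inj_on f (carrier W)"
begin

lemma transport_simps:
  "carrier (transport f W) = f ` carrier W" "zer (transport f W) = f (zer W)"
  "x \<in> carrier W \<Longrightarrow> y \<in> carrier W \<Longrightarrow> add (transport f W) (f x) (f y) = f (add W x y)"
  "x \<in> carrier W \<Longrightarrow> scal (transport f W) a (f x) = f (scal W a x)"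
  "x \<in> carrier W \<Longrightarrow> nrm (transport f W) (f x) = nrm W x"
  by (simp_all add: transport_def Let_def the_inv_into_f_f[OF f])

lemma operator_transport: "operator W (transport f W) f"
  unfolding operator_def by (auto simp: transport_simps intro: exI[of _ 1])

lemma operator_the_inv_into_transport:
  assumes "banach_sp W"
  shows "operator (transport f W) W (the_inv_into (carrier W) f)"
  unfolding operator_def
  by (auto simp: transport_simps the_inv_into_f_f[OF f] banach_sp_add_closed[OF assms]
      banach_sp_scal_closed[OF assms] intro: exI[of _ 1])

lemma banach_sp_transport:
  assumes W: "banach_sp W"
  shows "banach_sp (transport f W)" (is "banach_sp ?Z")
  unfolding banach_sp_def
proof (intro conjI)
  show "\<forall>x\<in>carrier ?Z. \<forall>y\<in>carrier ?Z. add ?Z x y = add ?Z y x"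
    by (auto simp: transport_simps intro!: arg_cong[of _ _ f] banach_sp_add_commute[OF W])
  show "\<forall>x\<in>carrier ?Z. \<exists>y\<in>carrier ?Z. add ?Z x y = zer ?Z"
  proof
    fix s assume "s \<in> carrier ?Z"
    then obtain x where x: "x \<in> carrier W" "s = f x" by (auto simp: transport_simps(1))
    obtain y where "y \<in> carrier W" "add W x y = zer W"
      using banach_sp_add_inverse[OF W x(1)] by blast
    then show "\<exists>t\<in>carrier ?Z. add ?Z s t = zer ?Z"
      using x by (intro bexI[of _ "f y"]) (simp_all add: transport_simps)
  qed
  show "\<forall>s :: nat \<Rightarrow> 'b. (\<forall>n. s n \<in> carrier ?Z) \<longrightarrow>
      (\<forall>e>0. \<exists>N. \<forall>m\<ge>N. \<forall>n\<ge>N. nrm ?Z (add ?Z (s m) (scal ?Z (- 1) (s n))) < e) \<longrightarrow>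
      (\<exists>l\<in>carrier ?Z. \<forall>e>0. \<exists>N. \<forall>n\<ge>N. nrm ?Z (add ?Z (s n) (scal ?Z (- 1) l)) < e)"
  proof (intro allI impI)
    fix s :: "nat \<Rightarrow> 'b"
    assume "\<forall>n. s n \<in> carrier ?Z"
      and Cauchy: "\<forall>e>0. \<exists>N. \<forall>m\<ge>N. \<forall>n\<ge>N. nrm ?Z (add ?Z (s m) (scal ?Z (- 1) (s n))) < e"
    then obtain t where t: "\<And>n. t n \<in> carrier W" "\<And>n. s n = f (t n)"
      unfolding transport_simps(1) image_iff by metis
    have dist: "nrm ?Z (add ?Z (f x) (scal ?Z (- 1) (f y))) = nrm W (add W x (scal W (- 1) y))"
      if "x \<in> carrier W" "y \<in> carrier W" for x y
      using that
      by (simp add: transport_simps banach_sp_add_closed[OF W] banach_sp_scal_closed[OF W])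
    have "\<exists>l\<in>carrier W. \<forall>e>0. \<exists>N. \<forall>n\<ge>N. nrm W (add W (t n) (scal W (- 1) l)) < e"
      using Cauchy unfolding t(2) dist[OF t(1) t(1)] by (intro banach_sp_complete[OF W t(1)]) blast
    then show "\<exists>l\<in>carrier ?Z. \<forall>e>0. \<exists>N. \<forall>n\<ge>N. nrm ?Z (add ?Z (s n) (scal ?Z (- 1) l)) < e"
      by (auto simp: t dist transport_simps(1))
  qed
qed (simp_all add: transport_simps inj_on_eq_iff[OF f] banach_sp_zer_closed[OF W]
    banach_sp_add_closed[OF W] banach_sp_scal_closed[OF W] banach_sp_add_assoc[OF W]
    banach_sp_add_zer[OF W] banach_sp_scal_add_right[OF W] banach_sp_scal_add_left[OF W]
    banach_sp_scal_scal[OF W] banach_sp_scal_one[OF W] banach_sp_nrm_eq_0[OF W]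
    banach_sp_nrm_scal[OF W] banach_sp_nrm_triangle[OF W])

lemma homeomorphic_map_weak_top_transport:
  assumes W: "banach_sp W"
  shows "homeomorphic_map (weak_top W) (weak_top (transport f W)) f"
proof -
  have "homeomorphic_maps (weak_top W) (weak_top (transport f W)) f (the_inv_into (carrier W) f)"
    unfolding homeomorphic_maps_def topspace_weak_top transport_simps(1)
    using continuous_map_weak_top[OF operator_transport banach_sp_transport[OF W]]
      continuous_map_weak_top[OF operator_the_inv_into_transport[OF W] W]
    by (simp add: f f_the_inv_into_f the_inv_into_f_f)
  then show ?thesis by (simp add: homeomorphic_maps_map)
qed

lemma weakly_compact_op_transport_id:
  assumes W: "banach_sp W" and "weakly_compact_op W W id"
  shows "weakly_compact_op (transport f W) (transport f W) id"
proof -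
  let ?Z = "transport f W" and ?B = "{x \<in> carrier W. nrm W x \<le> 1}"
  have "{z \<in> carrier ?Z. nrm ?Z z \<le> 1} = f ` ?B" by (auto simp: transport_simps)
  then have "weak_top ?Z closure_of {z \<in> carrier ?Z. nrm ?Z z \<le> 1} = f ` (weak_top W closure_of ?B)"
    using homeomorphic_map_closure_of[OF homeomorphic_map_weak_top_transport[OF W], of ?B]
    by (simp add: topspace_weak_top subset_iff)
  moreover have "compactin (weak_top ?Z) (f ` (weak_top W closure_of ?B))"
    using assms(2) homeomorphic_map_compactness[OF homeomorphic_map_weak_top_transport[OF W]]
    by (simp add: weakly_compact_op_def closure_of_subset_topspace)
  ultimately show ?thesis by (simp add: weakly_compact_op_def operator_id)
qed

end

section \<open>Weak convergence in Banach spaces\<close>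

lemma limitin_weak_top_type_sp_iff:
  fixes f :: "'i \<Rightarrow> 'y::real_normed_vector"
  shows "limitin (weak_top type_sp) f l F \<longleftrightarrow>
    (\<forall>\<phi> :: 'y \<Rightarrow> real. bounded_linear \<phi> \<longrightarrow> ((\<lambda>i. \<phi> (f i)) \<longlongrightarrow> \<phi> l) F)"
  using limitin_weak_topD[of "type_sp :: 'y nspace" f l F]
    limitin_weak_topI[of l "type_sp :: 'y nspace" f F]
  by (auto simp: operator_type_sp_iff)

lemma tendsto_imp_limitin_weak_top:
  fixes f :: "'i \<Rightarrow> 'y::real_normed_vector"
  shows "(f \<longlongrightarrow> l) F \<Longrightarrow> limitin (weak_top type_sp) f l F"
  by (simp add: limitin_weak_top_type_sp_iff bounded_linear.tendsto)

lemma limitin_weak_top_diff: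
  assumes "limitin (weak_top type_sp) f l F" "limitin (weak_top type_sp) g m F"
  shows "limitin (weak_top type_sp) (\<lambda>i. f i - g i) (l - m) F"
  using assms unfolding limitin_weak_top_type_sp_iff
  by (auto simp: linear_diff bounded_linear.linear intro!: tendsto_diff)

lemma sublinear_weak_limit_le:
  fixes f :: "'i \<Rightarrow> 'y::real_normed_vector"
  assumes p: "sublinear p" "\<And>y. p y \<le> B * norm y"
    and "F \<noteq> bot" "limitin (weak_top type_sp) f l F" "eventually (\<lambda>i. p (f i) \<le> c) F"
  shows "p l \<le> c"
proof -
  obtain \<phi> where \<phi>: "bounded_linear \<phi>" "\<And>y. \<phi> y \<le> p y" "\<phi> l = p l"
    using ex_supporting_functional[OF p, of l] by blast
  have "((\<lambda>i. \<phi> (f i)) \<longlongrightarrow> \<phi> l) F"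
    using assms(4) \<phi>(1) unfolding limitin_weak_top_type_sp_iff by blast
  moreover have "eventually (\<lambda>i. \<phi> (f i) \<le> c) F"
    using assms(5) by eventually_elim (use \<phi>(2) order_trans in blast)
  ultimately have "\<phi> l \<le> c" by (rule tendsto_upperbound[OF _ _ assms(3)])
  then show ?thesis by (simp add: \<phi>(3))
qed

lemma Mazur:
  fixes f :: "'i \<Rightarrow> 'y::real_normed_vector"
  assumes lim: "limitin (weak_top type_sp) f l F" and "frequently (\<lambda>i. f i \<in> T) F" and T: "convex T"
  shows "l \<in> closure T"
proof (rule ccontr)
  assume "l \<notin> closure T"
  then obtain d where d: "0 < d" "\<And>t. t \<in> T \<Longrightarrow> d \<le> norm (t - l)"
    unfolding closure_approachable by (auto simp: dist_norm not_less)
  have ne: "T \<noteq> {}" using frequently_ex[OF assms(2)] by blast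
  obtain \<phi> :: "'y \<Rightarrow> real" where \<phi>: "bounded_linear \<phi>" "\<And>s. s \<in> (\<lambda>t. t - l) ` T \<Longrightarrow> d \<le> \<phi> s"
    by (rule Hahn_Banach_convex[of norm 1 "(\<lambda>t. t - l) ` T" d])
      (use ne d(2) T in \<open>auto simp: seminorm_norm seminorm_imp_sublinear
        convex_translation_subtract_eq\<close>)
  have "((\<lambda>i. \<phi> (f i)) \<longlongrightarrow> \<phi> l) F"
    using lim \<phi>(1) unfolding limitin_weak_top_type_sp_iff by blast
  then have "eventually (\<lambda>i. \<phi> (f i) < \<phi> l + d) F"
    by (rule order_tendstoD) (simp add: d)
  then have "eventually (\<lambda>i. f i \<notin> T) F"
  proof eventually_elim
    case (elim i)
    show ?case
    proof
      assume "f i \<in> T"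
      then have "d \<le> \<phi> (f i - l)" by (intro \<phi>(2)) blast
      then show False using elim by (simp add: linear_diff[OF bounded_linear.linear[OF \<phi>(1)]])
    qed
  qed
  then show False using assms(2) by (simp add: frequently_def)
qed

lemma Hausdorff_weak_top_type_sp:
  "Hausdorff_space (weak_top (type_sp :: 'y::real_normed_vector nspace))"
  unfolding Hausdorff_space_def topspace_weak_top
proof (intro allI impI, elim conjE)
  fix x y :: 'y assume "x \<noteq> y"
  obtain \<phi> where \<phi>: "bounded_linear \<phi>" "\<phi> (x - y) = norm (x - y)"
    using ex_supporting_functional[of norm 1 "x - y"]
    by (metis mult_1 order_refl seminorm_imp_sublinear seminorm_norm)
  then have "\<phi> x \<noteq> \<phi> y"
    using \<open>x \<noteq> y\<close> by (auto simp: linear_diff[OF bounded_linear.linear[OF \<phi>(1)]])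
  then obtain U V where UV: "open U" "open V" "\<phi> x \<in> U" "\<phi> y \<in> V" "U \<inter> V = {}"
    using hausdorff[of "\<phi> x" "\<phi> y"] by blast
  have "openin (weak_top (type_sp :: 'y nspace)) (\<phi> -` W)" if "open W" for W
    using openin_weak_top_vimage[of "type_sp :: 'y nspace" \<phi> W] \<phi>(1) that
    by (simp add: operator_type_sp_iff)
  then show "\<exists>U V. openin (weak_top type_sp) U \<and> openin (weak_top type_sp) V \<and>
      x \<in> U \<and> y \<in> V \<and> disjnt U V"
    using UV by (intro exI[of _ "\<phi> -` U"] exI[of _ "\<phi> -` V"]) (auto simp: disjnt_def)
qed

lemma Hausdorff_weak_top_injective_operator:
  fixes T :: "'z \<Rightarrow> 'y::banach"
  assumes T: "operator Z type_sp T" "inj_on T (carrier Z)"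
  shows "Hausdorff_space (weak_top Z)"
  by (rule Hausdorff_space_injective_preimage[OF Hausdorff_weak_top_type_sp
        continuous_map_weak_top[OF T(1) banach_sp_type_sp]]) (simp add: topspace_weak_top T(2))

lemma uniform_limit_weak_limit:
  fixes f :: "'i \<Rightarrow> 'y::banach" and g :: "nat \<Rightarrow> 'i \<Rightarrow> 'y"
  assumes F: "F \<noteq> bot" "eventually (\<lambda>i. i \<in> I) F"
    and g: "\<And>n. limitin (weak_top type_sp) (g n) (u n) F"
    and fg: "uniform_limit I g f sequentially"
  obtains l where "limitin (weak_top type_sp) f l F"
proof -
  have "Cauchy u"
  proof (rule metric_CauchyI)
    fix e :: real assume "0 < e"
    then obtain N where N: "\<And>i m n. i \<in> I \<Longrightarrow> N \<le> m \<Longrightarrow> N \<le> n \<Longrightarrow> dist (g m i) (g n i) < e / 2"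
      using uniformly_convergent_Cauchy[OF uniformly_convergentI[OF fg]]
      unfolding uniformly_Cauchy_on_def by (metis half_gt_zero)
    have "norm (u m - u n) \<le> e / 2" if "N \<le> m" "N \<le> n" for m n
    proof (rule sublinear_weak_limit_le[where p = norm and B = 1])
      show "limitin (weak_top type_sp) (\<lambda>i. g m i - g n i) (u m - u n) F"
        by (intro limitin_weak_top_diff g)
      show "eventually (\<lambda>i. norm (g m i - g n i) \<le> e / 2) F"
        using F(2) by eventually_elim (use N that in \<open>simp add: dist_norm less_imp_le\<close>)
    qed (simp_all add: F(1) seminorm_norm seminorm_imp_sublinear)
    then show "\<exists>N. \<forall>m\<ge>N. \<forall>n\<ge>N. dist (u m) (u n) < e"
      using \<open>0 < e\<close> by (intro exI[of _ N]) (fastforce simp: dist_norm)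
  qed
  then obtain l where l: "u \<longlonglongrightarrow> l" using Cauchy_convergent convergent_def by blast
  have "((\<lambda>i. \<phi> (f i)) \<longlongrightarrow> \<phi> l) F" if \<phi>: "bounded_linear \<phi>" for \<phi> :: "'y \<Rightarrow> real"
  proof (rule swap_uniform_limit'[OF _ bounded_linear.tendsto[OF \<phi> l]
        bounded_linear.uniform_limit[OF \<phi> fg] F(2)])
    show "eventually (\<lambda>n. ((\<lambda>i. \<phi> (g n i)) \<longlongrightarrow> \<phi> (u n)) F) sequentially"
      using g \<phi> by (simp add: limitin_weak_top_type_sp_iff)
  qed simp
  then show thesis by (intro that[of l]) (simp add: limitin_weak_top_type_sp_iff)
qed

text \<open>Grothendieck's criterion for relative weak compactness.\<close>

theorem ultrafilter_weak_limit_if_approximated: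
  fixes f :: "'i \<Rightarrow> 'y::banach"
  assumes F: "ultrafilter F" "eventually (\<lambda>i. f i \<in> S) F"
    and approx: "\<And>\<eta>. 0 < \<eta> \<Longrightarrow> \<exists>K. compactin (weak_top type_sp) K \<and> (\<forall>y\<in>S. \<exists>k\<in>K. norm (y - k) \<le> \<eta>)"
  obtains l where "limitin (weak_top type_sp) f l F"
proof -
  have "\<exists>K. compactin (weak_top type_sp) K \<and>
      (\<forall>y\<in>S. \<exists>k\<in>K. norm (y - k) \<le> inverse (real (Suc n)))" for n
    by (rule approx) simp
  then obtain K where K: "\<And>n. compactin (weak_top (type_sp :: 'y nspace)) (K n)"
    and SK: "\<And>n y. y \<in> S \<Longrightarrow> \<exists>k\<in>K n. norm (y - k) \<le> inverse (real (Suc n))" by metis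
  define I where "I = {i. f i \<in> S}"
  have "\<exists>h. \<forall>i\<in>I. h i \<in> K n \<and> norm (f i - h i) \<le> inverse (real (Suc n))" for n
    by (rule bchoice) (use SK in \<open>auto simp: I_def\<close>)
  then obtain g where g: "\<And>n. \<forall>i\<in>I. g n i \<in> K n \<and> norm (f i - g n i) \<le> inverse (real (Suc n))"
    by metis
  have "\<exists>u. limitin (weak_top type_sp) (g n) u F" for n
  proof -
    have "eventually (\<lambda>i. g n i \<in> K n) F"
      using F(2) by eventually_elim (use g in \<open>simp add: I_def\<close>)
    then show ?thesis using compactin_imp_ultrafilter_limit[OF K F(1)] by metis
  qed
  then obtain u where u: "\<And>n. limitin (weak_top type_sp) (g n) (u n) F" by metis
  have "uniform_limit I g f sequentially"
    unfolding uniform_limit_iff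
  proof (intro allI impI)
    fix e :: real assume "0 < e"
    then have "eventually (\<lambda>n. inverse (real (Suc n)) < e) sequentially"
      by (rule order_tendstoD(2)[OF LIMSEQ_inverse_real_of_nat])
    then show "eventually (\<lambda>n. \<forall>i\<in>I. dist (g n i) (f i) < e) sequentially"
      by eventually_elim (use g le_less_trans in \<open>fastforce simp: dist_norm norm_minus_commute\<close>)
  qed
  moreover have "eventually (\<lambda>i. i \<in> I) F" using F(2) by (simp add: I_def)
  ultimately show thesis
    using uniform_limit_weak_limit[of F I g u f] ultrafilter_not_bot[OF F(1)] u that by blast
qed

section \<open>Sets almost absorbed by an operator\<close>

definition almost_absorbs ::
  "('x::real_normed_vector \<Rightarrow> 'y::real_normed_vector) \<Rightarrow> 'y set \<Rightarrow> bool" where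
  "almost_absorbs A S \<longleftrightarrow> (\<forall>\<eta>>0. \<exists>R. \<forall>y\<in>S. \<exists>x. norm x \<le> R \<and> norm (y - A x) \<le> \<eta>)"

lemma almost_absorbs_subset: "almost_absorbs A S \<Longrightarrow> T \<subseteq> S \<Longrightarrow> almost_absorbs A T"
  unfolding almost_absorbs_def by (meson subsetD)

lemma almost_absorbs_subset_closure:
  assumes "almost_absorbs A S"
  shows "S \<subseteq> closure (range A)"
proof
  fix y assume "y \<in> S"
  have "\<exists>z\<in>range A. norm (z - y) < e" if "0 < e" for e
  proof -
    obtain x where "norm (y - A x) \<le> e / 2"
      using assms \<open>y \<in> S\<close> \<open>0 < e\<close> unfolding almost_absorbs_def by (metis half_gt_zero)
    then show ?thesis using \<open>0 < e\<close> by (intro bexI[of _ "A x"]) (simp_all add: norm_minus_commute)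
  qed
  then show "y \<in> closure (range A)" by (simp add: closure_approachable dist_norm)
qed

lemma weakly_compact_op_bounded_image:
  fixes A :: "'x::real_normed_vector \<Rightarrow> 'y::banach"
  assumes A: "weakly_compact_op type_sp type_sp A" and "0 < R"
  obtains K where "compactin (weak_top type_sp) K" "\<And>x. norm x \<le> R \<Longrightarrow> A x \<in> K"
proof -
  interpret A: bounded_linear A
    using A by (simp add: weakly_compact_op_def operator_type_sp_iff)
  define K where "K = weak_top (type_sp :: 'y nspace) closure_of (A ` {x. norm x \<le> 1})"
  have "compactin (weak_top (type_sp :: 'y nspace)) K"
    using A by (simp add: weakly_compact_op_def K_def)
  then have "compactin (weak_top type_sp) ((*\<^sub>R) R ` K)"
    by (rule image_compactin)
      (simp add: continuous_map_weak_top operator_type_sp_iff banach_sp_type_sp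
        bounded_linear_scaleR_right)
  moreover have "A x \<in> (*\<^sub>R) R ` K" if "norm x \<le> R" for x
  proof (rule image_eqI)
    have "A ` {x. norm x \<le> 1} \<subseteq> K"
      unfolding K_def by (rule closure_of_subset) (simp add: topspace_weak_top)
    moreover have "norm (x /\<^sub>R R) \<le> 1" using that \<open>0 < R\<close> by (simp add: field_simps)
    ultimately show "A (x /\<^sub>R R) \<in> K" by blast
    show "A x = R *\<^sub>R A (x /\<^sub>R R)" using \<open>0 < R\<close> by (simp add: A.scaleR)
  qed
  ultimately show thesis by (rule that)
qed

lemma almost_absorbs_ultrafilter_weak_limit:
  fixes A :: "'x::real_normed_vector \<Rightarrow> 'y::banach"
  assumes A: "weakly_compact_op type_sp type_sp A" "almost_absorbs A S"
    and F: "ultrafilter F" "eventually (\<lambda>i. f i \<in> S) F"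
  obtains l where "limitin (weak_top type_sp) f l F"
proof (rule ultrafilter_weak_limit_if_approximated[OF F])
  fix \<eta> :: real assume "0 < \<eta>"
  then obtain R where R: "\<And>y. y \<in> S \<Longrightarrow> \<exists>x. norm x \<le> R \<and> norm (y - A x) \<le> \<eta>"
    using A(2) unfolding almost_absorbs_def by blast
  obtain K where "compactin (weak_top type_sp) K" "\<And>x. norm x \<le> max R 1 \<Longrightarrow> A x \<in> K"
    using weakly_compact_op_bounded_image[OF A(1), of "max R 1"]
    by (metis less_max_iff_disj zero_less_one)
  then show "\<exists>K. compactin (weak_top type_sp) K \<and> (\<forall>y\<in>S. \<exists>k\<in>K. norm (y - k) \<le> \<eta>)"
    using R by (metis max.coboundedI1)
qed (rule that)

lemma ex_inj_on_closure_range: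
  fixes A :: "'x \<Rightarrow> 'y::metric_space"
  obtains f :: "'y \<Rightarrow> nat \<Rightarrow> 'x" where "inj_on f (closure (range A))"
proof -
  have "\<exists>s. (\<lambda>n. A (s n)) \<longlonglongrightarrow> y" if "y \<in> closure (range A)" for y
  proof -
    from that obtain t where t: "\<And>n. t n \<in> range A" "t \<longlonglongrightarrow> y"
      unfolding closure_sequential by blast
    then obtain s where "\<And>n. t n = A (s n)" using choice[of "\<lambda>n x. t n = A x"] by blast
    then have "t = (\<lambda>n. A (s n))" by (rule ext)
    then show ?thesis using t(2) by blast
  qed
  then have "\<exists>f. \<forall>y\<in>closure (range A). (\<lambda>n. A (f y n)) \<longlonglongrightarrow> y" by (intro bchoice ballI)
  then obtain f where f: "\<And>y. y \<in> closure (range A) \<Longrightarrow> (\<lambda>n. A (f y n)) \<longlonglongrightarrow> y" by blast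
  have "inj_on f (closure (range A))"
  proof (rule inj_onI)
    fix y z assume "y \<in> closure (range A)" "z \<in> closure (range A)" "f y = f z"
    then show "y = z" using f[of y] f[of z] by (simp add: LIMSEQ_unique)
  qed
  then show thesis by (rule that)
qed

section \<open>Schreier families\<close>

lemma schreier_finite: "E \<in> schreier \<xi> \<Longrightarrow> finite E"
  by (induction \<xi> arbitrary: E) fastforce+

lemma Max_less_Min_iff:
  fixes A B :: "nat set"
  assumes "finite A" "A \<noteq> {}" "finite B" "B \<noteq> {}"
  shows "Max A < Min B \<longleftrightarrow> (\<forall>a\<in>A. \<forall>b\<in>B. a < b)"
  using assms by auto

lemma schreier_OSucc_iff:
  "E \<in> schreier (OSucc \<xi>) \<longleftrightarrow> (\<exists>n F. 1 \<le> n \<and> (\<forall>i<n. F i \<noteq> {} \<and> F i \<in> schreier \<xi>) \<and>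
    (\<forall>i. Suc i < n \<longrightarrow> (\<forall>a\<in>F i. \<forall>b\<in>F (Suc i). a < b)) \<and> (\<forall>a\<in>F 0. n \<le> a) \<and> E = (\<Union>i<n. F i))"
  unfolding schreier.simps mem_Collect_eq
proof (intro ex_cong1 conj_cong refl)
  fix n :: nat and F :: "nat \<Rightarrow> nat set"
  assume n: "1 \<le> n" and F: "\<forall>i<n. F i \<noteq> {} \<and> F i \<in> schreier \<xi>"
  have fin: "finite (F i)" "F i \<noteq> {}" if "i < n" for i using F that schreier_finite by auto
  then have "Max (F i) < Min (F (Suc i)) \<longleftrightarrow> (\<forall>a\<in>F i. \<forall>b\<in>F (Suc i). a < b)" if "Suc i < n" for i
    using that by (intro Max_less_Min_iff) auto
  then show "(\<forall>i. Suc i < n \<longrightarrow> Max (F i) < Min (F (Suc i))) \<longleftrightarrow>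
      (\<forall>i. Suc i < n \<longrightarrow> (\<forall>a\<in>F i. \<forall>b\<in>F (Suc i). a < b))"
    by blast
  show "n \<le> Min (F 0) \<longleftrightarrow> (\<forall>a\<in>F 0. n \<le> a)" using fin[of 0] n by simp
qed

lemma schreier_OLim_iff:
  "E \<in> schreier (OLim f) \<longleftrightarrow> (\<exists>n. (\<forall>a\<in>E. Suc n \<le> a) \<and> E \<in> schreier (f n))"
proof -
  have "E = {} \<or> Suc n \<le> Min E \<longleftrightarrow> (\<forall>a\<in>E. Suc n \<le> a)" if "E \<in> schreier (f n)" for n
    using schreier_finite[OF that] by (cases "E = {}") (simp_all add: Suc_le_eq)
  then show ?thesis by auto
qed

declare schreier.simps(2,3) [simp del]

lemma schreier_ge_1: "E \<in> schreier \<xi> \<Longrightarrow> a \<in> E \<Longrightarrow> 1 \<le> a"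
proof (induction \<xi> arbitrary: E)
  case (OSucc \<xi>)
  then show ?case unfolding schreier_OSucc_iff by blast
next
  case (OLim f)
  then show ?case unfolding schreier_OLim_iff by blast
qed auto

lemma schreier_subset_OSucc:
  assumes "E \<in> schreier \<xi>" "E \<noteq> {}"
  shows "E \<in> schreier (OSucc \<xi>)"
  unfolding schreier_OSucc_iff
  using assms schreier_ge_1[OF assms(1)]
  by (intro exI[of _ 1] exI[of _ "\<lambda>_. E"]) (simp add: lessThan_Suc)

lemma schreier_singleton: "1 \<le> j \<Longrightarrow> {j} \<in> schreier \<xi>"
proof (induction \<xi>)
  case (OSucc \<xi>)
  then show ?case by (simp only: schreier_subset_OSucc insert_not_empty not_False_eq_True)
qed (auto simp del: schreier.simps(3) simp: schreier_OLim_iff intro: exI[of _ 0])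

lemma schreier_OSucc_OZero_iff:
  "E \<in> schreier (OSucc OZero) \<longleftrightarrow> finite E \<and> E \<noteq> {} \<and> (\<forall>a\<in>E. card E \<le> a)"
proof
  assume "E \<in> schreier (OSucc OZero)"
  then obtain n F where n: "1 \<le> n" and F: "\<And>i. i < n \<Longrightarrow> F i \<noteq> {} \<and> F i \<in> schreier OZero"
    and lt: "\<And>i a b. Suc i < n \<Longrightarrow> a \<in> F i \<Longrightarrow> b \<in> F (Suc i) \<Longrightarrow> a < b"
    and F0: "\<And>a. a \<in> F 0 \<Longrightarrow> n \<le> a" and E: "E = (\<Union>i<n. F i)"
    unfolding schreier_OSucc_iff by blast
  have "card E \<le> (\<Sum>i<n. card (F i))" unfolding E by (rule card_UN_le) simp
  also have "\<dots> \<le> (\<Sum>i<n. 1)" using F by (intro sum_mono) auto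
  finally have "card E \<le> n" by simp
  moreover have "n \<le> a" if "i < n" "a \<in> F i" for i a
    using that
  proof (induction i arbitrary: a)
    case (Suc i)
    obtain b where "b \<in> F i" using F[of i] Suc.prems by auto
    then show ?case using Suc.IH[of b] lt[of i b a] Suc.prems by simp
  qed (rule F0)
  moreover have "finite E" using F by (auto simp: E)
  moreover have "E \<noteq> {}" using F[of 0] n by (fastforce simp: E)
  ultimately show "finite E \<and> E \<noteq> {} \<and> (\<forall>a\<in>E. card E \<le> a)"
    by (auto simp: E intro: le_trans)
next
  assume E: "finite E \<and> E \<noteq> {} \<and> (\<forall>a\<in>E. card E \<le> a)"
  define l where "l = sorted_list_of_set E"
  have l: "length l = card E" "set l = E" "sorted_wrt (<) l" using E by (auto simp: l_def)
  have card: "1 \<le> card E" using E by (simp add: Suc_le_eq card_gt_0_iff)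
  have "card E \<le> l ! i" if "i < card E" for i using E l that by (metis nth_mem)
  then have "\<forall>i<card E. {l ! i} \<in> schreier OZero" using card by fastforce
  moreover have "l ! i < l ! Suc i" if "Suc i < card E" for i
    using sorted_wrt_nth_less[OF l(3), of i "Suc i"] that l(1) by simp
  moreover have "E = (\<Union>i<card E. {l ! i})" using l by (auto simp: set_conv_nth)
  ultimately show "E \<in> schreier (OSucc OZero)"
    unfolding schreier_OSucc_iff using E card l
    by (intro exI[of _ "card E"] exI[of _ "\<lambda>i. {l ! i}"]) (auto simp del: schreier.simps)
qed

lemma ord_wf_OSuccD: "ord_wf (OSucc \<xi>) \<Longrightarrow> ord_wf \<xi>"
  by (erule ord_wf.cases) auto

lemma ord_wf_OLimD:
  assumes "ord_wf (OLim f)"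
  shows "ord_wf (f n)" "f (Suc n) \<noteq> OZero"
proof -
  have f: "ord_wf (f n) \<and> ord_less (f n) (f (Suc n))" for n
    using assms by cases auto
  then show "ord_wf (f n)" by blast
  have "ord_le (OSucc (f n)) (f (Suc n))" using f by (simp add: ord_less_def)
  then show "f (Suc n) \<noteq> OZero" by cases auto
qed

lemma schreier_OSucc_OZero_subset:
  assumes "ord_wf \<xi>" "\<xi> \<noteq> OZero" "E \<in> schreier (OSucc OZero)"
  shows "E \<in> schreier \<xi>"
  using assms
proof (induction \<xi> rule: ordn.induct)
  case (OSucc \<xi>)
  show ?case
  proof (cases "\<xi> = OZero")
    case False
    then have "E \<in> schreier \<xi>" using OSucc ord_wf_OSuccD by blast
    moreover have "E \<noteq> {}" using OSucc.prems(3) by (simp add: schreier_OSucc_OZero_iff)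
    ultimately show ?thesis by (rule schreier_subset_OSucc)
  qed (use OSucc.prems in simp)
next
  case (OLim f)
  have E: "finite E" "E \<noteq> {}" "\<forall>a\<in>E. card E \<le> a"
    using OLim.prems(3) by (simp_all add: schreier_OSucc_OZero_iff)
  show ?case
  proof (cases "1 \<in> E")
    case True
    then have "card E = 1" using E by (metis One_nat_def Suc_leI card_gt_0_iff le_antisym)
    then have "E = {1}" using True by (metis card_1_singletonE singletonD)
    then show ?thesis by (simp only: schreier_singleton order_refl)
  next
    case False
    have "Suc 1 \<le> a" if "a \<in> E" for a
    proof -
      have "card E > 0" using E by (simp add: card_gt_0_iff)
      then have "0 < a" using E(3) that by (meson less_le_trans)
      moreover have "a \<noteq> 1" using False that by blast
      ultimately show ?thesis by simp
    qed
    moreover have "E \<in> schreier (f 1)"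
      using OLim.IH[of "f 1"] OLim.prems ord_wf_OLimD[OF OLim.prems(1)] by simp
    ultimately show ?thesis unfolding schreier_OLim_iff by (intro exI[of _ 1]) blast
  qed
qed simp

definition successive :: "(nat \<Rightarrow> nat set) \<Rightarrow> bool" where
  "successive B \<longleftrightarrow> (\<forall>a. B a \<noteq> {}) \<and> (\<forall>a. \<forall>i\<in>B a. a \<le> i) \<and> (\<forall>a b. a < b \<longrightarrow> (\<forall>i\<in>B a. \<forall>j\<in>B b. i < j))"

lemma schreier_OSucc_UN_successive:
  assumes B: "successive B" and E: "E \<in> schreier (OSucc \<xi>)"
    and \<xi>: "\<And>G. G \<in> schreier \<xi> \<Longrightarrow> (\<Union>a\<in>G. B a) \<in> schreier \<xi>"
  shows "(\<Union>a\<in>E. B a) \<in> schreier (OSucc \<xi>)"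
proof -
  obtain n F where F: "1 \<le> n" "\<forall>i<n. F i \<noteq> {} \<and> F i \<in> schreier \<xi>"
    "\<forall>i. Suc i < n \<longrightarrow> (\<forall>a\<in>F i. \<forall>b\<in>F (Suc i). a < b)" "\<forall>a\<in>F 0. n \<le> a" "E = (\<Union>i<n. F i)"
    using E unfolding schreier_OSucc_iff by blast
  have ne: "B a \<noteq> {}" and ge: "j \<in> B a \<Longrightarrow> a \<le> j" and lt: "a < b \<Longrightarrow> j \<in> B a \<Longrightarrow> k \<in> B b \<Longrightarrow> j < k"
    for a b j k
    using B unfolding successive_def by blast+
  have "\<forall>i<n. (\<Union>a\<in>F i. B a) \<noteq> {} \<and> (\<Union>a\<in>F i. B a) \<in> schreier \<xi>"
    using F(2) \<xi> ne by simp
  moreover have "\<forall>i. Suc i < n \<longrightarrow> (\<forall>j\<in>(\<Union>a\<in>F i. B a). \<forall>k\<in>(\<Union>a\<in>F (Suc i). B a). j < k)"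
    using F(3) lt by blast
  moreover have "\<forall>j\<in>(\<Union>a\<in>F 0. B a). n \<le> j"
    using F(4) ge by (meson UN_E le_trans)
  moreover have "(\<Union>a\<in>E. B a) = (\<Union>i<n. \<Union>a\<in>F i. B a)" by (auto simp: F(5))
  ultimately show ?thesis
    unfolding schreier_OSucc_iff using F(1) by (intro exI[of _ n] exI[of _ "\<lambda>i. \<Union>a\<in>F i. B a"]) simp
qed

lemma schreier_OLim_UN_successive:
  assumes B: "successive B" and E: "\<And>a. a \<in> E \<Longrightarrow> Suc n \<le> a" and "(\<Union>a\<in>E. B a) \<in> schreier (f n)"
  shows "(\<Union>a\<in>E. B a) \<in> schreier (OLim f)"
proof -
  have "Suc n \<le> i" if "a \<in> E" "i \<in> B a" for a i
    using E[OF that(1)] B that(2) unfolding successive_def by (meson le_trans)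
  then show ?thesis unfolding schreier_OLim_iff using assms(3) by blast
qed

lemma schreier_image_strict_mono:
  assumes r: "strict_mono (r :: nat \<Rightarrow> nat)" and "E \<in> schreier \<xi>"
  shows "r ` E \<in> schreier \<xi>"
proof -
  have r_ge: "a \<le> r a" for a by (rule strict_mono_imp_increasing[OF r])
  then have r': "successive (\<lambda>a. {r a})" using r by (simp add: successive_def strict_mono_less)
  show ?thesis
    using assms(2)
  proof (induction \<xi> arbitrary: E)
    case OZero
    have "1 \<le> r a" if "1 \<le> a" for a using that r_ge[of a] by linarith
    then have "r ` E \<subseteq> {1..}" using OZero by auto
    then show ?case using OZero card_image_le[of E r] by simp
  next
    case (OSucc \<xi>)
    then show ?case
      using schreier_OSucc_UN_successive[OF r', of E \<xi>] by (simp only: UNION_singleton_eq_range)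
  next
    case (OLim f)
    then obtain n where "\<And>a. a \<in> E \<Longrightarrow> Suc n \<le> a" "E \<in> schreier (f n)"
      unfolding schreier_OLim_iff by blast
    then show ?case
      using schreier_OLim_UN_successive[OF r', of E n f] OLim.IH
      by (simp only: UNION_singleton_eq_range rangeI)
  qed
qed

definition block :: "nat \<Rightarrow> nat \<Rightarrow> nat set" where
  "block m j = {j * m..<j * m + m}"

lemma mem_block_iff: "0 < m \<Longrightarrow> i \<in> block m j \<longleftrightarrow> i div m = j"
  using dividend_less_times_div[of m i] times_div_less_eq_dividend[of m i]
  by (auto simp: block_def mult.commute intro: div_nat_eqI)

lemma finite_block [simp]: "finite (block m j)" and card_block [simp]: "card (block m j) = m"
  by (simp_all add: block_def)

lemma disjoint_block: "0 < m \<Longrightarrow> i \<noteq> j \<Longrightarrow> block m i \<inter> block m j = {}"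
  by (auto simp: mem_block_iff)

lemma successive_block:
  assumes "0 < m"
  shows "successive (block m)"
proof -
  have "block m j \<noteq> {}" for j using assms by (simp add: block_def)
  moreover have "i < j" if "i div m < j div m" for i j using that by (metis div_le_mono leD leI)
  ultimately show ?thesis
    unfolding successive_def Ball_def mem_block_iff[OF assms] by (metis div_le_dividend)
qed

lemma schreier_OSucc_OZero_UN_block:
  assumes "0 < m" "F \<in> schreier (OSucc OZero)"
  shows "(\<Union>j\<in>F. block m j) \<in> schreier (OSucc OZero)"
proof -
  have F: "finite F" "F \<noteq> {}" "\<And>j. j \<in> F \<Longrightarrow> card F \<le> j"
    using assms(2) by (simp_all add: schreier_OSucc_OZero_iff)
  have "card (\<Union>j\<in>F. block m j) = (\<Sum>j\<in>F. card (block m j))"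
    by (rule card_UN_disjoint) (use F(1) disjoint_block[OF assms(1)] in auto)
  then have card: "card (\<Union>j\<in>F. block m j) = card F * m" by simp
  have "card F * m \<le> i" if "j \<in> F" "i \<in> block m j" for i j
    by (rule order_trans[OF mult_le_mono1[OF F(3)[OF that(1)]]])
      (use that(2) in \<open>simp add: block_def\<close>)
  then show ?thesis
    unfolding schreier_OSucc_OZero_iff card
    using F(1,2) successive_block[OF assms(1)] by (auto simp: successive_def)
qed

text \<open>This fails for \<open>\<xi> = 0\<close>; it is the only use of \<open>0 < \<xi>\<close>.\<close>

lemma schreier_UN_block:
  assumes "ord_wf \<xi>" "\<xi> \<noteq> OZero" "0 < m" "F \<in> schreier \<xi>"
  shows "(\<Union>j\<in>F. block m j) \<in> schreier \<xi>"
  using assms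
proof (induction \<xi> arbitrary: F rule: ordn.induct)
  case (OSucc \<xi>)
  show ?case
  proof (cases "\<xi> = OZero")
    case True
    then show ?thesis using schreier_OSucc_OZero_UN_block OSucc.prems(3,4) by blast
  next
    case False
    then show ?thesis
      using OSucc.prems ord_wf_OSuccD
      by (intro schreier_OSucc_UN_successive successive_block OSucc.IH) blast+
  qed
next
  case (OLim f)
  then obtain n where n: "\<And>a. a \<in> F \<Longrightarrow> Suc n \<le> a" "F \<in> schreier (f n)"
    unfolding schreier_OLim_iff by blast
  show ?case
  proof (cases "F \<in> schreier (OSucc OZero)")
    case True
    then show ?thesis
      using schreier_OSucc_OZero_UN_block schreier_OSucc_OZero_subset OLim.prems(1,2,3) by blast
  next
    case False
    have "(\<Union>j\<in>F. block m j) \<in> schreier (f n)"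
    proof (cases "f n = OZero")
      case True
      then have "F = {}" using False n(2) schreier_subset_OSucc[of F OZero] by auto
      then show ?thesis using n(2) by simp
    qed (use OLim.IH[of "f n"] OLim.prems(3) ord_wf_OLimD[OF OLim.prems(1)] n(2) in simp)
    then show ?thesis
      by (intro schreier_OLim_UN_successive[OF successive_block[OF OLim.prems(3)] n(1)])
  qed
qed simp

section \<open>Lower l1 estimates on Schreier sets\<close>

definition l1_lower :: "ordn \<Rightarrow> ('a::real_vector \<Rightarrow> real) \<Rightarrow> real \<Rightarrow> (nat \<Rightarrow> 'a) \<Rightarrow> bool" where
  "l1_lower \<xi> p \<delta> z \<longleftrightarrow> (\<forall>E\<in>schreier \<xi>. \<forall>a. \<delta> * (\<Sum>i\<in>E. \<bar>a i\<bar>) \<le> p (\<Sum>i\<in>E. a i *\<^sub>R z i))"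

lemma l1_lowerD:
  "l1_lower \<xi> p \<delta> z \<Longrightarrow> E \<in> schreier \<xi> \<Longrightarrow> \<delta> * (\<Sum>i\<in>E. \<bar>a i\<bar>) \<le> p (\<Sum>i\<in>E. a i *\<^sub>R z i)"
  by (simp add: l1_lower_def)

lemma l1_spreading_model_normed_subspace_iff:
  "l1_spreading_model \<xi> (normed_subspace S p) z \<longleftrightarrow>
    (\<forall>i. z i \<in> S) \<and> (\<exists>M. \<forall>i. p (z i) \<le> M) \<and> (\<exists>\<delta>>0. l1_lower \<xi> p \<delta> z)"
proof -
  have "(\<exists>K>0. l1_lower \<xi> p (1 / K) z) \<longleftrightarrow> (\<exists>\<delta>>0. l1_lower \<xi> p \<delta> z)"
    by (metis divide_divide_eq_right div_by_1 mult_1 zero_less_divide_1_iff)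
  then show ?thesis
    by (simp add: l1_spreading_model_def l1_lower_def
        nsum_normed_subspace[OF schreier_finite] cong: ball_cong)
qed

lemma l1_spreading_model_type_sp_iff:
  "l1_spreading_model \<xi> type_sp z \<longleftrightarrow> (\<exists>M. \<forall>i. norm (z i) \<le> M) \<and> (\<exists>\<delta>>0. l1_lower \<xi> norm \<delta> z)"
  by (simp add: type_sp_eq_normed_subspace l1_spreading_model_normed_subspace_iff)

lemma l1_lower_strict_mono:
  assumes r: "strict_mono r" and z: "l1_lower \<xi> p \<delta> z"
  shows "l1_lower \<xi> p \<delta> (\<lambda>i. z (r i))"
  unfolding l1_lower_def
proof (intro ballI allI)
  fix E a assume E: "E \<in> schreier \<xi>"
  have inj: "inj r" using r by (rule strict_mono_imp_inj_on)
  have "\<delta> * (\<Sum>i\<in>r ` E. \<bar>a (inv r i)\<bar>) \<le> p (\<Sum>i\<in>r ` E. a (inv r i) *\<^sub>R z i)"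
    by (rule l1_lowerD[OF z schreier_image_strict_mono[OF r E]])
  then show "\<delta> * (\<Sum>i\<in>E. \<bar>a i\<bar>) \<le> p (\<Sum>i\<in>E. a i *\<^sub>R z (r i))"
    by (simp add: sum.reindex inj_on_subset[OF inj] inv_f_f[OF inj])
qed

lemma l1_lower_perturbation:
  fixes u v :: "nat \<Rightarrow> 'a::real_normed_vector"
  assumes u: "l1_lower \<xi> norm \<delta> u" and uv: "\<And>i. norm (u i - v i) \<le> \<eta>"
  shows "l1_lower \<xi> norm (\<delta> - \<eta>) v"
  unfolding l1_lower_def
proof (intro ballI allI)
  fix E a assume E: "E \<in> schreier \<xi>"
  have "\<delta> * (\<Sum>i\<in>E. \<bar>a i\<bar>) \<le> norm (\<Sum>i\<in>E. a i *\<^sub>R u i)"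
    by (rule l1_lowerD[OF u E])
  also have "(\<Sum>i\<in>E. a i *\<^sub>R u i) = (\<Sum>i\<in>E. a i *\<^sub>R v i) + (\<Sum>i\<in>E. a i *\<^sub>R (u i - v i))"
    by (simp add: sum.distrib[symmetric] scaleR_diff_right)
  also have "norm \<dots> \<le> norm (\<Sum>i\<in>E. a i *\<^sub>R v i) + norm (\<Sum>i\<in>E. a i *\<^sub>R (u i - v i))"
    by (rule norm_triangle_ineq)
  also have "norm (\<Sum>i\<in>E. a i *\<^sub>R (u i - v i)) \<le> (\<Sum>i\<in>E. \<bar>a i\<bar> * \<eta>)"
    by (rule sum_norm_le) (simp add: mult_left_mono uv)
  also have "\<dots> = \<eta> * (\<Sum>i\<in>E. \<bar>a i\<bar>)" by (simp add: sum_distrib_left mult.commute)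
  finally show "(\<delta> - \<eta>) * (\<Sum>i\<in>E. \<bar>a i\<bar>) \<le> norm (\<Sum>i\<in>E. a i *\<^sub>R v i)"
    by (simp add: algebra_simps)
qed

definition block_average :: "nat \<Rightarrow> (nat \<Rightarrow> 'a::real_vector) \<Rightarrow> nat \<Rightarrow> 'a" where
  "block_average m z j = (\<Sum>i\<in>block m j. (1 / real m) *\<^sub>R z i)"

definition block_coeff :: "nat \<Rightarrow> (nat \<Rightarrow> real) \<Rightarrow> nat \<Rightarrow> real" where
  "block_coeff m b i = b (i div m) / real m"

context
  fixes m :: nat and F :: "nat set"
  assumes m: "0 < m" and F: "finite F"
begin

lemma sum_UN_block: "(\<Sum>i\<in>(\<Union>j\<in>F. block m j). g i) = (\<Sum>j\<in>F. \<Sum>i\<in>block m j. g i)"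
  by (rule sum.UNION_disjoint) (use F disjoint_block[OF m] in auto)

lemma sum_block_coeff:
  "(\<Sum>i\<in>(\<Union>j\<in>F. block m j). block_coeff m b i *\<^sub>R z i) = (\<Sum>j\<in>F. b j *\<^sub>R block_average m z j)"
  unfolding sum_UN_block block_average_def scaleR_sum_right
  by (intro sum.cong refl) (simp add: block_coeff_def mem_block_iff[OF m])

lemma sum_abs_block_coeff: "(\<Sum>i\<in>(\<Union>j\<in>F. block m j). \<bar>block_coeff m b i\<bar>) = (\<Sum>j\<in>F. \<bar>b j\<bar>)"
proof -
  have "(\<Sum>i\<in>block m j. \<bar>block_coeff m b i\<bar>) = (\<Sum>i\<in>block m j. \<bar>b j\<bar> / real m)" for j
    by (intro sum.cong refl) (simp add: block_coeff_def mem_block_iff[OF m])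
  then show ?thesis using m by (simp add: sum_UN_block)
qed

lemma L2_set_block_coeff: "L2_set (block_coeff m b) (\<Union>j\<in>F. block m j) = L2_set b F / sqrt (real m)"
proof -
  have "(\<Sum>i\<in>block m j. (block_coeff m b i)\<^sup>2) = (\<Sum>i\<in>block m j. (b j / real m)\<^sup>2)" for j
    by (intro sum.cong refl) (simp add: block_coeff_def mem_block_iff[OF m])
  then have "(\<Sum>i\<in>block m j. (block_coeff m b i)\<^sup>2) = (b j)\<^sup>2 / real m" for j
    using m by (simp add: power2_eq_square)
  then show ?thesis
    by (simp add: L2_set_def sum_UN_block sum_divide_distrib[symmetric] real_sqrt_divide)
qed

end

lemma block_average_in_convex:
  assumes "convex S" "\<And>i. z i \<in> S" "0 < m"
  shows "block_average m z j \<in> S"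
  unfolding block_average_def using assms by (intro convex_sum) auto

lemma l1_lower_block_average:
  assumes "ord_wf \<xi>" "\<xi> \<noteq> OZero" "0 < m" and z: "l1_lower \<xi> p \<delta> z"
  shows "l1_lower \<xi> p \<delta> (block_average m z)"
  unfolding l1_lower_def
proof (intro ballI allI)
  fix F b assume F: "F \<in> schreier \<xi>"
  have "\<delta> * (\<Sum>i\<in>(\<Union>j\<in>F. block m j). \<bar>block_coeff m b i\<bar>)
      \<le> p (\<Sum>i\<in>(\<Union>j\<in>F. block m j). block_coeff m b i *\<^sub>R z i)"
    by (rule l1_lowerD[OF z schreier_UN_block[OF assms(1-3) F]])
  then show "\<delta> * (\<Sum>j\<in>F. \<bar>b j\<bar>) \<le> p (\<Sum>j\<in>F. b j *\<^sub>R block_average m z j)"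
    by (simp add: sum_block_coeff sum_abs_block_coeff assms(3) schreier_finite[OF F])
qed

section \<open>Operators and l1 spreading models\<close>

lemma l1_spreading_model_if_image:
  assumes Z: "banach_sp Z" and W: "banach_sp W" and T: "operator Z W T"
    and x: "\<And>i. x i \<in> carrier Z" "\<And>i. nrm Z (x i) \<le> M" and Tx: "l1_spreading_model \<xi> W (T \<circ> x)"
  shows "l1_spreading_model \<xi> Z x"
proof -
  obtain K where K: "0 < K" and low: "\<And>E a. E \<in> schreier \<xi> \<Longrightarrow>
      1 / K * (\<Sum>i\<in>E. \<bar>a i\<bar>) \<le> nrm W (nsum W E (\<lambda>i. scal W (a i) ((T \<circ> x) i)))"
    using Tx unfolding l1_spreading_model_def by blast
  obtain L where L: "\<forall>x\<in>carrier Z. nrm W (T x) \<le> L * nrm Z x"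
    using T unfolding operator_def by blast
  have "1 / (K * (\<bar>L\<bar> + 1)) * (\<Sum>i\<in>E. \<bar>a i\<bar>) \<le> nrm Z (nsum Z E (\<lambda>i. scal Z (a i) (x i)))"
    if "E \<in> schreier \<xi>" for E a
  proof -
    let ?s = "nsum Z E (\<lambda>i. scal Z (a i) (x i))"
    have closed: "scal Z (a i) (x i) \<in> carrier Z" for i by (rule banach_sp_scal_closed[OF Z x(1)])
    then have s: "?s \<in> carrier Z" by (rule nsum_closed[OF Z])
    have "T ?s = nsum W E (\<lambda>i. scal W (a i) ((T \<circ> x) i))"
      using T x(1) by (simp add: operator_nsum[OF T Z W closed] operator_def)
    then have "1 / K * (\<Sum>i\<in>E. \<bar>a i\<bar>) \<le> nrm W (T ?s)" using low[OF that, of a] by simp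
    also have "\<dots> \<le> L * nrm Z ?s" using L s by blast
    also have "\<dots> \<le> (\<bar>L\<bar> + 1) * nrm Z ?s"
      by (intro mult_right_mono banach_sp_nrm_nonneg[OF Z s]) simp
    finally show ?thesis using K by (simp add: divide_simps mult_ac)
  qed
  moreover have "0 < K * (\<bar>L\<bar> + 1)" using K by simp
  ultimately show ?thesis unfolding l1_spreading_model_def using x by blast
qed

lemma almost_absorbs_l1_spreading_model:
  fixes A :: "'x::banach \<Rightarrow> 'y::banach"
  assumes A: "operator type_sp type_sp A" "almost_absorbs A (range u)"
    and u: "l1_spreading_model \<xi> type_sp u"
  obtains x where "l1_spreading_model \<xi> type_sp x" "l1_spreading_model \<xi> type_sp (A \<circ> x)"
proof -
  obtain M \<delta> where M: "\<And>j. norm (u j) \<le> M" and \<delta>: "0 < \<delta>" "l1_lower \<xi> norm \<delta> u"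
    using u unfolding l1_spreading_model_type_sp_iff by blast
  obtain R where "\<forall>j. \<exists>x. norm x \<le> R \<and> norm (u j - A x) \<le> \<delta> / 2"
    using A(2) \<delta>(1) unfolding almost_absorbs_def by (meson half_gt_zero rangeI)
  then obtain x where x: "\<And>j. norm (x j) \<le> R" "\<And>j. norm (u j - A (x j)) \<le> \<delta> / 2" by metis
  have "norm (A (x j)) \<le> M + \<delta> / 2" for j
    using norm_triangle_ineq4[of "u j" "u j - A (x j)"] M[of j] x(2)[of j] by simp
  moreover have "l1_lower \<xi> norm (\<delta> / 2) (A \<circ> x)"
    using l1_lower_perturbation[OF \<delta>(2) x(2)] by (simp add: comp_def)
  ultimately have Ax: "l1_spreading_model \<xi> type_sp (A \<circ> x)"
    unfolding l1_spreading_model_type_sp_iff using \<delta>(1) by (auto intro: exI[of _ "\<delta> / 2"])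
  moreover have "l1_spreading_model \<xi> type_sp x"
    by (rule l1_spreading_model_if_image[OF banach_sp_type_sp banach_sp_type_sp A(1) _ _ Ax, of R])
      (simp_all add: x(1))
  ultimately show thesis using that by blast
qed

lemma SM1_id_iff: "SM1 \<xi> Z Z id \<longleftrightarrow> (\<nexists>x. l1_spreading_model \<xi> Z x)"
  by (simp add: SM1_def operator_id)

lemma SM1_transport_id:
  assumes f: "inj_on f (carrier W)" and W: "banach_sp W" and "SM1 \<xi> W W id"
  shows "SM1 \<xi> (transport f W) (transport f W) id"
  unfolding SM1_id_iff
proof
  assume "\<exists>s. l1_spreading_model \<xi> (transport f W) s"
  then obtain s where s: "l1_spreading_model \<xi> (transport f W) s" by blast
  then obtain M where sM: "\<And>i. s i \<in> f ` carrier W" "\<And>i. nrm (transport f W) (s i) \<le> M"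
    by (auto simp: l1_spreading_model_def transport_simps(1)[OF f])
  then obtain x where x: "\<And>i. x i \<in> carrier W" "s = f \<circ> x"
    unfolding image_iff fun_eq_iff comp_def by metis
  have "l1_spreading_model \<xi> W x"
  proof (rule l1_spreading_model_if_image[OF W banach_sp_transport[OF f W]
        operator_transport[OF f] x(1)])
    show "nrm W (x i) \<le> M" for i using sM(2)[of i] by (simp add: x transport_simps[OF f])
    show "l1_spreading_model \<xi> (transport f W) (f \<circ> x)" using s by (simp add: x(2))
  qed
  then show False using assms(3) by (simp add: SM1_id_iff)
qed

section \<open>Subsequences with an upper l2 estimate\<close>

lemma ex_div_sqrt_less:
  fixes b e :: real
  assumes "0 < e"
  obtains n :: nat where "0 < n" "b / sqrt (real n) < e"
proof -
  obtain n :: nat where n: "(b / e)\<^sup>2 < real n" using reals_Archimedean2 by blast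
  then have "0 < real n" by (meson le_less_trans zero_le_power2)
  moreover have "b / e < sqrt (real n)" using n by (rule real_less_rsqrt)
  ultimately show thesis using that[of n] assms by (simp add: field_simps)
qed

lemma L2_set_subset_mono: "finite B \<Longrightarrow> A \<subseteq> B \<Longrightarrow> L2_set f A \<le> L2_set f B"
  unfolding L2_set_def by (intro real_sqrt_le_mono sum_mono2) auto

lemma power2_L2_set: "(L2_set f A)\<^sup>2 = (\<Sum>i\<in>A. (f i)\<^sup>2)"
  by (simp add: L2_set_def sum_nonneg)

lemma L2_set_abs: "L2_set (\<lambda>i. \<bar>f i\<bar>) A = L2_set f A"
  by (simp add: L2_set_def)

lemma sum_mult_le_L2_set:
  fixes f g :: "'a \<Rightarrow> real"
  shows "(\<Sum>n\<in>A. f n * g n) \<le> L2_set f A * L2_set g A"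
proof -
  have "(\<Sum>n\<in>A. f n * g n) \<le> (\<Sum>n\<in>A. \<bar>f n\<bar> * \<bar>g n\<bar>)"
    by (intro sum_mono) (metis abs_ge_self abs_mult)
  then show ?thesis using L2_set_mult_ineq[of f g A] by linarith
qed

lemma L2_set_bounded_tail:
  fixes f :: "nat \<Rightarrow> real"
  assumes M: "\<And>k. L2_set f {..<k} \<le> M" and "0 < e"
  obtains p where "\<And>k. L2_set f {p..<k} \<le> e"
proof -
  have "summable (\<lambda>n. (f n)\<^sup>2)"
  proof (rule summableI_nonneg_bounded)
    show "(\<Sum>n<k. (f n)\<^sup>2) \<le> M\<^sup>2" for k
      using M[of k] by (simp add: L2_set_def sqrt_le_D)
  qed simp
  then obtain p where "\<And>k. norm (\<Sum>n\<in>{p..<k}. (f n)\<^sup>2) < e\<^sup>2"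
    unfolding summable_Cauchy using \<open>0 < e\<close> by (meson order_refl zero_less_power)
  then have "L2_set f {p..<k} \<le> e" for k
    unfolding L2_set_def using \<open>0 < e\<close> by (intro real_le_lsqrt) (auto simp: sum_nonneg less_imp_le)
  then show thesis by (rule that)
qed

lemma sum_power2_linear_combination:
  fixes f :: "'i \<Rightarrow> 'n \<Rightarrow> real"
  shows "(\<Sum>n\<in>A. (\<Sum>i\<in>F. c i * f i n)\<^sup>2) = (\<Sum>i\<in>F. \<Sum>j\<in>F. c i * c j * (\<Sum>n\<in>A. f i n * f j n))"
proof -
  have "(\<Sum>n\<in>A. (\<Sum>i\<in>F. c i * f i n)\<^sup>2) = (\<Sum>n\<in>A. \<Sum>i\<in>F. \<Sum>j\<in>F. c i * c j * (f i n * f j n))"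
    by (simp add: power2_eq_square sum_product mult_ac)
  also have "\<dots> = (\<Sum>i\<in>F. \<Sum>n\<in>A. \<Sum>j\<in>F. c i * c j * (f i n * f j n))"
    by (rule sum.swap)
  also have "\<dots> = (\<Sum>i\<in>F. \<Sum>j\<in>F. c i * c j * (\<Sum>n\<in>A. f i n * f j n))"
    unfolding sum_distrib_left by (intro sum.cong refl sum.swap)
  finally show ?thesis .
qed

lemma L2_set_almost_orthogonal_le:
  fixes f :: "'i \<Rightarrow> 'n \<Rightarrow> real"
  assumes F: "finite F" and c: "\<And>i. i \<in> F \<Longrightarrow> 0 \<le> c i" and "0 \<le> M" "0 \<le> e"
    and M: "\<And>i. i \<in> F \<Longrightarrow> L2_set (f i) A \<le> M"
    and e: "\<And>i j. i \<in> F \<Longrightarrow> j \<in> F \<Longrightarrow> i \<noteq> j \<Longrightarrow> (\<Sum>n\<in>A. f i n * f j n) \<le> e\<^sup>2"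
  shows "L2_set (\<lambda>n. \<Sum>i\<in>F. c i * f i n) A \<le> e * sum c F + M * L2_set c F"
proof (rule power2_le_imp_le)
  have gram: "(\<Sum>n\<in>A. f i n * f j n) \<le> (if i = j then M\<^sup>2 else 0) + e\<^sup>2" if "i \<in> F" "j \<in> F" for i j
  proof (cases "i = j")
    case True
    have "(\<Sum>n\<in>A. f i n * f i n) = (L2_set (f i) A)\<^sup>2"
      by (simp add: power2_L2_set power2_eq_square[of "f i _"])
    also have "\<dots> \<le> M\<^sup>2" using M[OF that(1)] by (intro power_mono) auto
    finally show ?thesis using True by (simp add: add_increasing2)
  qed (use e that in simp)
  have "(L2_set (\<lambda>n. \<Sum>i\<in>F. c i * f i n) A)\<^sup>2 = (\<Sum>i\<in>F. \<Sum>j\<in>F. c i * c j * (\<Sum>n\<in>A. f i n * f j n))"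
    by (simp only: power2_L2_set sum_power2_linear_combination)
  also have "\<dots> \<le> (\<Sum>i\<in>F. \<Sum>j\<in>F. c i * c j * ((if i = j then M\<^sup>2 else 0) + e\<^sup>2))"
    by (intro sum_mono mult_left_mono gram mult_nonneg_nonneg c)
  also have "\<dots> = (\<Sum>i\<in>F. \<Sum>j\<in>F. if i = j then M\<^sup>2 * (c i)\<^sup>2 else 0) + (\<Sum>i\<in>F. \<Sum>j\<in>F. e\<^sup>2 * (c i * c j))"
    unfolding sum.distrib[symmetric]
    by (intro sum.cong refl) (auto simp: algebra_simps power2_eq_square)
  also have "\<dots> = M\<^sup>2 * (L2_set c F)\<^sup>2 + e\<^sup>2 * (sum c F)\<^sup>2"
    unfolding power2_L2_set power2_eq_square[of "sum c F"] sum_product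
    using F by (simp add: sum_distrib_left)
  also have "\<dots> \<le> (e * sum c F + M * L2_set c F)\<^sup>2"
    using \<open>0 \<le> M\<close> \<open>0 \<le> e\<close> c by (simp add: power2_sum power_mult_distrib sum_nonneg)
  finally show "(L2_set (\<lambda>n. \<Sum>i\<in>F. c i * f i n) A)\<^sup>2 \<le> (e * sum c F + M * L2_set c F)\<^sup>2" .
  show "0 \<le> e * sum c F + M * L2_set c F"
    using \<open>0 \<le> M\<close> \<open>0 \<le> e\<close> c by (simp add: sum_nonneg)
qed

lemma eventually_pairs_subseq:
  assumes U: "U \<noteq> bot" "U \<le> sequentially" and P: "\<And>i. eventually (P i) U"
  obtains r :: "nat \<Rightarrow> nat" where "strict_mono r" "\<And>i j. i < j \<Longrightarrow> P (r i) (r j)"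
proof -
  have "\<exists>r. \<forall>n::nat. \<forall>k<n. r k < r n \<and> P (r k) (r n)"
  proof (rule dependent_wf_choice[OF wf_less_than, where P = "\<lambda>r n x. \<forall>k<n. r k < x \<and> P (r k) x"])
    fix n and r :: "nat \<Rightarrow> nat"
    have "eventually (\<lambda>x. k < x \<and> P k x) U" for k
      using filter_leD[OF U(2) eventually_gt_at_top[of k]] P[of k] by eventually_elim auto
    then have "eventually (\<lambda>x. \<forall>k\<in>{..<n}. r k < x \<and> P (r k) x) U"
      by (auto simp: eventually_ball_finite_distrib)
    from eventually_happens'[OF U(1) this] show "\<exists>x. \<forall>k<n. r k < x \<and> P (r k) x"
      by (simp add: lessThan_def)
  qed auto
  then obtain r where "\<forall>n::nat. \<forall>k<n. r k < r n \<and> P (r k) (r n)" ..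
  then show thesis using that[of r] by (auto simp: strict_mono_def)
qed

lemma L2_bounded_ultrafilter_limit:
  fixes f :: "'i \<Rightarrow> nat \<Rightarrow> real"
  assumes U: "ultrafilter U" and M: "\<And>i k. L2_set (f i) {..<k} \<le> M"
  obtains g where "\<And>n. ((\<lambda>i. f i n) \<longlongrightarrow> g n) U" "\<And>k. L2_set g {..<k} \<le> M"
proof -
  have abs_le: "\<bar>f i n\<bar> \<le> M" for i n
    using member_le_L2_set[of "{..<Suc n}" n "\<lambda>n. \<bar>f i n\<bar>"] M[of i "Suc n"]
    by (simp add: L2_set_abs)
  have "\<exists>l. ((\<lambda>i. f i n) \<longlongrightarrow> l) U" for n
  proof (rule ultrafilter_bounded_tendsto[OF U, of "- M" "\<lambda>i. f i n" M])
    show "- M \<le> f i n" "f i n \<le> M" for i using abs_le[of i n] by linarith+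
  qed blast
  then obtain g where g: "\<And>n. ((\<lambda>i. f i n) \<longlongrightarrow> g n) U" by metis
  have "L2_set g {..<k} \<le> M" for k
  proof (rule tendsto_upperbound[OF _ _ ultrafilter_not_bot[OF U]])
    show "((\<lambda>i. L2_set (f i) {..<k}) \<longlongrightarrow> L2_set g {..<k}) U"
      unfolding L2_set_def by (intro tendsto_intros g)
  qed (use M in simp)
  then show thesis using that g by blast
qed

text \<open>Beyond some \<open>P\<close> the tail of \<open>x\<close> is small; between \<open>p\<close> and \<open>P\<close>, \<open>f j\<close> is close to \<open>g\<close>, whose
  tail beyond \<open>p\<close> is small. Hence \<open>p\<close> does not depend on \<open>x\<close>.\<close>

lemma eventually_tail_product_le:
  fixes x :: "nat \<Rightarrow> real" and f :: "'i \<Rightarrow> nat \<Rightarrow> real"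
  assumes x: "\<And>n. 0 \<le> x n" "\<And>k. L2_set x {..<k} \<le> M"
    and f: "\<And>j n. 0 \<le> f j n" "\<And>j k. L2_set (f j) {..<k} \<le> M"
    and g: "\<And>n. ((\<lambda>j. f j n) \<longlongrightarrow> g n) U" "\<And>k. L2_set g {p..<k} \<le> h"
    and h: "0 < h" "M * h < e / 2"
  shows "eventually (\<lambda>j. \<forall>k. (\<Sum>n\<in>{p..<k}. x n * f j n) \<le> e) U"
proof -
  have "0 \<le> M" using x(2)[of 0] by simp
  have tail: "L2_set y {a..<b} \<le> M" if "\<And>k. L2_set y {..<k} \<le> M" for y :: "nat \<Rightarrow> real" and a b
    by (rule order_trans[OF L2_set_subset_mono that[of b]]) auto
  obtain P where P: "\<And>k. L2_set x {P..<k} \<le> h"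
    using L2_set_bounded_tail[OF x(2) h(1)] by blast
  have "(\<Sum>n\<in>{p..<P}. x n * g n) \<le> L2_set x {p..<P} * L2_set g {p..<P}"
    by (rule sum_mult_le_L2_set)
  also have "\<dots> \<le> M * h" by (intro mult_mono tail x(2) g(2) \<open>0 \<le> M\<close> L2_set_nonneg)
  also note h(2)
  finally have "eventually (\<lambda>j. (\<Sum>n\<in>{p..<P}. x n * f j n) < e / 2) U"
    by (intro order_tendstoD(2)[of _ "\<Sum>n\<in>{p..<P}. x n * g n"] tendsto_intros g(1))
  then show ?thesis
  proof eventually_elim
    case (elim j)
    show ?case
    proof
      fix k
      have "(\<Sum>n\<in>{p..<k}. x n * f j n) \<le> (\<Sum>n\<in>{p..<P} \<union> {P..<k}. x n * f j n)"
        by (intro sum_mono2) (auto simp: x(1) f(1))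
      also have "\<dots> = (\<Sum>n\<in>{p..<P}. x n * f j n) + (\<Sum>n\<in>{P..<k}. x n * f j n)"
        by (intro sum.union_disjoint) auto
      also have "(\<Sum>n\<in>{P..<k}. x n * f j n) \<le> L2_set x {P..<k} * L2_set (f j) {P..<k}"
        by (rule sum_mult_le_L2_set)
      also have "\<dots> \<le> h * M" by (intro mult_mono tail f(2) P) (use h(1) in auto)
      finally show "(\<Sum>n\<in>{p..<k}. x n * f j n) \<le> e" using elim h(2) by (simp add: mult.commute)
    qed
  qed
qed

lemma L2_bounded_subseq_tail_products:
  fixes f :: "nat \<Rightarrow> nat \<Rightarrow> real"
  assumes pos: "\<And>i n. 0 \<le> f i n" and M: "\<And>i k. L2_set (f i) {..<k} \<le> M" and e: "0 < e"
  obtains r :: "nat \<Rightarrow> nat" and p where "strict_mono r"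
    "\<And>i j k. i \<noteq> j \<Longrightarrow> (\<Sum>n\<in>{p..<k}. f (r i) n * f (r j) n) \<le> e"
proof -
  obtain U :: "nat filter" where U: "ultrafilter U" "U \<le> sequentially"
    using ex_ultrafilter_le[OF sequentially_bot] by blast
  obtain g where g: "\<And>n. ((\<lambda>i. f i n) \<longlongrightarrow> g n) U" "\<And>k. L2_set g {..<k} \<le> M"
    using L2_bounded_ultrafilter_limit[of U f, OF U(1) M] by blast
  define h where "h = e / (4 * (M + 1))"
  have "0 \<le> M" using M[of 0 0] by simp
  then have h: "0 < h" "M * h < e / 2"
    using e by (auto simp: h_def field_simps add_strict_increasing)
  obtain p where p: "\<And>k. L2_set g {p..<k} \<le> h" using L2_set_bounded_tail[OF g(2) h(1)] by blast
  have "eventually (\<lambda>j. \<forall>k. (\<Sum>n\<in>{p..<k}. f i n * f j n) \<le> e) U" for i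
    by (rule eventually_tail_product_le[where x = "f i", OF pos M pos M g(1) p h])
  then obtain r :: "nat \<Rightarrow> nat" where r: "strict_mono r"
    and lt: "\<And>i j. i < j \<Longrightarrow> \<forall>k. (\<Sum>n\<in>{p..<k}. f (r i) n * f (r j) n) \<le> e"
    using eventually_pairs_subseq[OF ultrafilter_not_bot[OF U(1)] U(2),
        of "\<lambda>i j. \<forall>k. (\<Sum>n\<in>{p..<k}. f i n * f j n) \<le> e"] by blast
  have "(\<Sum>n\<in>{p..<k}. f (r i) n * f (r j) n) \<le> e" if "i \<noteq> j" for i j k
    using lt[of i j] lt[of j i] that
    by (cases i j rule: linorder_cases) (simp_all add: mult.commute)
  then show thesis using that r by blast
qed

lemma L2_bounded_subseq_tail_estimate:
  fixes f :: "nat \<Rightarrow> nat \<Rightarrow> real"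
  assumes pos: "\<And>i n. 0 \<le> f i n" and M: "\<And>i k. L2_set (f i) {..<k} \<le> M" and e: "0 < e"
  obtains r :: "nat \<Rightarrow> nat" and p where "strict_mono r"
    "\<And>F c k. finite F \<Longrightarrow> (\<And>i. 0 \<le> c i) \<Longrightarrow>
      L2_set (\<lambda>n. \<Sum>i\<in>F. c i * f (r i) n) {p..<k} \<le> e * sum c F + M * L2_set c F"
proof -
  obtain r :: "nat \<Rightarrow> nat" and p where r: "strict_mono r"
    and small: "\<And>i j k. i \<noteq> j \<Longrightarrow> (\<Sum>n\<in>{p..<k}. f (r i) n * f (r j) n) \<le> e\<^sup>2"
    using L2_bounded_subseq_tail_products[of f M "e\<^sup>2", OF pos M] e by auto
  have "0 \<le> M" using M[of 0 0] by simp
  have "L2_set (\<lambda>n. \<Sum>i\<in>F. c i * f (r i) n) {p..<k} \<le> e * sum c F + M * L2_set c F"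
    if "finite F" "\<And>i. 0 \<le> c i" for F and c :: "nat \<Rightarrow> real" and k
  proof (rule L2_set_almost_orthogonal_le)
    show "L2_set (f (r i)) {p..<k} \<le> M" for i
      by (rule order_trans[OF L2_set_subset_mono M[of "r i" k]]) auto
  qed (use that \<open>0 \<le> M\<close> e small in auto)
  then show thesis using that r by blast
qed

section \<open>The l2 sum of a sequence of equivalent norms\<close>

locale l2_sum_of_norms =
  fixes q :: "nat \<Rightarrow> 'y::banach \<Rightarrow> real" and c :: "nat \<Rightarrow> real" and L :: real
  assumes seminorm_q: "seminorm (q n)"
    and q_le_norm: "q n y \<le> c n * norm y"
    and norm_le_q: "norm y \<le> L * q 0 y"
    and L_pos: "0 < L"
begin

definition partial_norm :: "nat \<Rightarrow> 'y \<Rightarrow> real" where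
  "partial_norm k y = L2_set (\<lambda>n. q n y) {..<k}"

definition sum_space :: "'y set" where
  "sum_space = {y. bdd_above (range (\<lambda>k. partial_norm k y))}"

definition sum_norm :: "'y \<Rightarrow> real" where
  "sum_norm y = (SUP k. partial_norm k y)"

abbreviation sum_sp :: "'y nspace" where
  "sum_sp \<equiv> normed_subspace sum_space sum_norm"

lemma q_nonneg: "0 \<le> q n y"
  by (rule seminorm_nonneg[OF seminorm_q])

lemma seminorm_partial_norm: "seminorm (partial_norm k)"
proof -
  have "partial_norm k (x + y) \<le> partial_norm k x + partial_norm k y" for x y
  proof -
    have "partial_norm k (x + y) \<le> L2_set (\<lambda>n. q n x + q n y) {..<k}"
      unfolding partial_norm_def by (intro L2_set_mono seminorm_add seminorm_q q_nonneg)
    also have "\<dots> \<le> partial_norm k x + partial_norm k y"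
      unfolding partial_norm_def by (rule L2_set_triangle_ineq)
    finally show ?thesis .
  qed
  moreover have "partial_norm k (a *\<^sub>R y) = \<bar>a\<bar> * partial_norm k y" for a y
    by (simp add: partial_norm_def seminorm_scale[OF seminorm_q] L2_set_right_distrib)
  ultimately show ?thesis by (simp add: seminorm_def)
qed

lemma partial_norm_le_norm: "partial_norm k y \<le> (\<Sum>n<k. c n) * norm y"
proof -
  have "partial_norm k y \<le> (\<Sum>n<k. q n y)"
    unfolding partial_norm_def by (intro L2_set_le_sum q_nonneg)
  also have "\<dots> \<le> (\<Sum>n<k. c n * norm y)" by (intro sum_mono q_le_norm)
  finally show ?thesis by (simp add: sum_distrib_right)
qed

lemma
  assumes "\<And>k. partial_norm k y \<le> B"
  shows sum_spaceI: "y \<in> sum_space" and sum_norm_least: "sum_norm y \<le> B"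
  unfolding sum_space_def sum_norm_def using assms by (auto intro!: bdd_aboveI cSUP_least)

lemma partial_norm_le_sum_norm: "y \<in> sum_space \<Longrightarrow> partial_norm k y \<le> sum_norm y"
  unfolding sum_space_def sum_norm_def by (auto intro: cSUP_upper)

lemma q_le_sum_norm: "y \<in> sum_space \<Longrightarrow> q n y \<le> sum_norm y"
  using partial_norm_le_sum_norm[of y "Suc n"] member_le_L2_set[of "{..<Suc n}" n "\<lambda>n. q n y"]
  by (simp add: partial_norm_def)

lemma sum_norm_nonneg: "y \<in> sum_space \<Longrightarrow> 0 \<le> sum_norm y"
  using q_le_sum_norm[of y 0] q_nonneg[of 0 y] by linarith

lemma norm_le_sum_norm: "y \<in> sum_space \<Longrightarrow> norm y \<le> L * sum_norm y"
  using norm_le_q[of y] q_le_sum_norm[of y 0] L_pos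
  by (meson mult_left_mono less_imp_le order_trans)

lemma
  assumes "x \<in> sum_space" "y \<in> sum_space"
  shows sum_space_add: "x + y \<in> sum_space"
    and sum_norm_add: "sum_norm (x + y) \<le> sum_norm x + sum_norm y"
proof -
  have "partial_norm k (x + y) \<le> sum_norm x + sum_norm y" for k
    using seminorm_add[OF seminorm_partial_norm, of k x y]
      partial_norm_le_sum_norm[OF assms(1), of k] partial_norm_le_sum_norm[OF assms(2), of k]
    by linarith
  then show "x + y \<in> sum_space" "sum_norm (x + y) \<le> sum_norm x + sum_norm y"
    by (rule sum_spaceI, rule sum_norm_least)
qed

lemma
  assumes "y \<in> sum_space"
  shows sum_space_scale: "a *\<^sub>R y \<in> sum_space"
    and sum_norm_scale: "sum_norm (a *\<^sub>R y) = \<bar>a\<bar> * sum_norm y"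
proof -
  have scale: "partial_norm k (a *\<^sub>R y) \<le> \<bar>a\<bar> * sum_norm y" if "y \<in> sum_space" for k a y
    using partial_norm_le_sum_norm[OF that]
    by (simp add: seminorm_scale[OF seminorm_partial_norm] mult_left_mono)
  then show closed: "a *\<^sub>R y \<in> sum_space" using assms by (intro sum_spaceI) blast
  show "sum_norm (a *\<^sub>R y) = \<bar>a\<bar> * sum_norm y"
  proof (cases "a = 0")
    case False
    have "sum_norm ((1 / a) *\<^sub>R a *\<^sub>R y) \<le> \<bar>1 / a\<bar> * sum_norm (a *\<^sub>R y)"
      by (intro sum_norm_least scale closed)
    then have "\<bar>a\<bar> * sum_norm y \<le> sum_norm (a *\<^sub>R y)" using False by (simp add: field_simps)
    then show ?thesis using sum_norm_least[OF scale[OF assms]] by (simp add: antisym)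
  qed (simp add: sum_norm_def partial_norm_def sublinear_0
      seminorm_imp_sublinear seminorm_q L2_set_0')
qed

lemma sum_norm_diff:
  assumes "x \<in> sum_space" "y \<in> sum_space"
  shows "sum_norm (x - y) \<le> sum_norm x + sum_norm y"
  using sum_norm_add[OF assms(1) sum_space_scale[OF assms(2), of "-1"]]
    sum_norm_scale[OF assms(2), of "-1"]
  by simp

lemma subspace_sum_space: "subspace sum_space"
proof -
  have "0 \<in> sum_space"
    by (rule sum_spaceI[of _ 0])
      (simp add: sublinear_0 seminorm_imp_sublinear seminorm_partial_norm)
  then show ?thesis by (simp add: subspace_def sum_space_add sum_space_scale)
qed

lemmas sum_space_diff = subspace_diff[OF subspace_sum_space]

lemma convex_sum_norm_ball: "convex {y \<in> sum_space. sum_norm y \<le> M}"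
proof (rule convexI)
  fix x y and s t :: real
  assume xy: "x \<in> {y \<in> sum_space. sum_norm y \<le> M}" "y \<in> {y \<in> sum_space. sum_norm y \<le> M}"
    and st: "0 \<le> s" "0 \<le> t" "s + t = 1"
  have "sum_norm (s *\<^sub>R x + t *\<^sub>R y) \<le> sum_norm (s *\<^sub>R x) + sum_norm (t *\<^sub>R y)"
    using xy by (intro sum_norm_add sum_space_scale) auto
  also have "\<dots> = s * sum_norm x + t * sum_norm y" using xy st by (simp add: sum_norm_scale)
  also have "\<dots> \<le> s * M + t * M" using xy st by (intro add_mono mult_left_mono) auto
  also have "\<dots> = M" using st by (simp flip: distrib_right)
  finally show "s *\<^sub>R x + t *\<^sub>R y \<in> {y \<in> sum_space. sum_norm y \<le> M}"
    using xy by (simp add: sum_space_add sum_space_scale)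
qed

lemma weak_limit_sum_norm_le:
  assumes "F \<noteq> bot" and f: "limitin (weak_top type_sp) f l F"
    and bound: "eventually (\<lambda>i. f i \<in> sum_space \<and> sum_norm (f i) \<le> B) F"
  shows "l \<in> sum_space" "sum_norm l \<le> B"
proof -
  have "partial_norm k l \<le> B" for k
  proof (rule sublinear_weak_limit_le[OF _ partial_norm_le_norm assms(1) f])
    show "eventually (\<lambda>i. partial_norm k (f i) \<le> B) F"
      using bound by eventually_elim (meson partial_norm_le_sum_norm order_trans)
  qed (intro seminorm_imp_sublinear seminorm_partial_norm)
  then show "l \<in> sum_space" "sum_norm l \<le> B" by (rule sum_spaceI, rule sum_norm_least)
qed

lemma Cauchy_if_sum_norm_Cauchy:
  fixes y :: "nat \<Rightarrow> 'y"
  assumes y: "\<And>n. y n \<in> sum_space"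
    and Cauchy: "\<And>e. 0 < e \<Longrightarrow> \<exists>N. \<forall>m\<ge>N. \<forall>n\<ge>N. sum_norm (y m - y n) < e"
  shows "Cauchy y"
proof (rule CauchyI)
  fix e :: real assume "0 < e"
  then obtain N where N: "\<forall>m\<ge>N. \<forall>n\<ge>N. sum_norm (y m - y n) < e / L"
    using Cauchy[of "e / L"] L_pos by auto
  have "norm (y m - y n) < e" if "N \<le> m" "N \<le> n" for m n
  proof -
    have "norm (y m - y n) \<le> L * sum_norm (y m - y n)" by (intro norm_le_sum_norm sum_space_diff y)
    also have "\<dots> < e" using N that L_pos by (simp add: field_simps)
    finally show ?thesis .
  qed
  then show "\<exists>N. \<forall>m\<ge>N. \<forall>n\<ge>N. norm (y m - y n) < e" by blast
qed

lemma sum_space_complete: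
  fixes y :: "nat \<Rightarrow> 'y"
  assumes y: "\<And>n. y n \<in> sum_space"
    and Cauchy: "\<And>e. 0 < e \<Longrightarrow> \<exists>N. \<forall>m\<ge>N. \<forall>n\<ge>N. sum_norm (y m - y n) < e"
  shows "\<exists>l\<in>sum_space. \<forall>e>0. \<exists>N. \<forall>n\<ge>N. sum_norm (y n - l) < e"
proof -
  obtain l where l: "y \<longlonglongrightarrow> l"
    using Cauchy_convergent[OF Cauchy_if_sum_norm_Cauchy[OF assms]] unfolding convergent_def
    by blast
  have lim: "\<exists>N. \<forall>n\<ge>N. y n - l \<in> sum_space \<and> sum_norm (y n - l) < e" if e: "0 < e" for e
  proof -
    obtain N where N: "\<And>m n. N \<le> m \<Longrightarrow> N \<le> n \<Longrightarrow> sum_norm (y m - y n) < e / 2"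
      using Cauchy[of "e / 2"] e by auto
    have "y n - l \<in> sum_space \<and> sum_norm (y n - l) \<le> e / 2" if "N \<le> n" for n
    proof -
      have "limitin (weak_top type_sp) (\<lambda>m. y n - y m) (y n - l) sequentially"
        by (intro tendsto_imp_limitin_weak_top tendsto_intros l)
      moreover have "eventually (\<lambda>m. y n - y m \<in> sum_space \<and>
          sum_norm (y n - y m) \<le> e / 2) sequentially"
        using eventually_ge_at_top[of N]
        by eventually_elim (use N[OF that] in \<open>simp add: sum_space_diff y less_imp_le\<close>)
      ultimately show ?thesis using weak_limit_sum_norm_le[OF sequentially_bot] by blast
    qed
    then show ?thesis using e by (intro exI[of _ N]) fastforce
  qed
  obtain n where "y n - l \<in> sum_space" using lim[of 1] by auto
  then have "l \<in> sum_space" using sum_space_diff[OF y[of n], of "y n - l"] by simp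
  then show ?thesis using lim by blast
qed

lemma banach_sp_sum: "banach_sp sum_sp"
proof (rule banach_sp_normed_subspace[OF subspace_sum_space sum_norm_add sum_norm_scale])
  show "y = 0" if "y \<in> sum_space" "sum_norm y = 0" for y
    using norm_le_sum_norm[OF that(1)] that(2) by simp
qed (auto intro: sum_space_complete)

lemma operator_sum_inclusion: "operator sum_sp type_sp id"
  unfolding operator_def by (auto intro!: exI[of _ L] norm_le_sum_norm)

definition l2_upper :: "real \<Rightarrow> real \<Rightarrow> real \<Rightarrow> (nat \<Rightarrow> 'y) \<Rightarrow> bool" where
  "l2_upper C e M z \<longleftrightarrow> (\<forall>F a. finite F \<longrightarrow> sum_norm (\<Sum>i\<in>F. a i *\<^sub>R z i)
    \<le> C * norm (\<Sum>i\<in>F. a i *\<^sub>R z i) + e * (\<Sum>i\<in>F. \<bar>a i\<bar>) + M * L2_set a F)"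

lemma l2_upperD:
  "l2_upper C e M z \<Longrightarrow> finite F \<Longrightarrow> sum_norm (\<Sum>i\<in>F. a i *\<^sub>R z i)
    \<le> C * norm (\<Sum>i\<in>F. a i *\<^sub>R z i) + e * (\<Sum>i\<in>F. \<bar>a i\<bar>) + M * L2_set a F"
  by (simp add: l2_upper_def)

text \<open>The first \<open>p\<close> coordinates are controlled by the ambient norm, the others by the upper l2
  estimate.\<close>

lemma bounded_subseq_l2_upper:
  assumes z: "\<And>i. z i \<in> sum_space" "\<And>i. sum_norm (z i) \<le> M" and e: "0 < e"
  obtains r :: "nat \<Rightarrow> nat" and C where "strict_mono r" "0 < C" "l2_upper C e M (\<lambda>i. z (r i))"
proof -
  have bound: "L2_set (\<lambda>n. q n (z i)) {..<k} \<le> M" for i k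
    using partial_norm_le_sum_norm[OF z(1)[of i], of k] z(2)[of i] by (simp add: partial_norm_def)
  obtain r :: "nat \<Rightarrow> nat" and p where r: "strict_mono r" and tail:
    "\<And>F c k. finite F \<Longrightarrow> (\<And>i. 0 \<le> c i) \<Longrightarrow>
      L2_set (\<lambda>n. \<Sum>i\<in>F. c i * q n (z (r i))) {p..<k} \<le> e * sum c F + M * L2_set c F"
    using L2_bounded_subseq_tail_estimate[of "\<lambda>i n. q n (z i)" M e, OF q_nonneg bound e] by blast
  define C where "C = \<bar>\<Sum>n<p. c n\<bar> + 1"
  have C: "partial_norm p y \<le> C * norm y" for y
  proof -
    have "(\<Sum>n<p. c n) * norm y \<le> C * norm y" by (intro mult_right_mono) (simp_all add: C_def)
    then show ?thesis using partial_norm_le_norm[of p y] by linarith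
  qed
  have "sum_norm (\<Sum>i\<in>F. a i *\<^sub>R z (r i))
      \<le> C * norm (\<Sum>i\<in>F. a i *\<^sub>R z (r i)) + e * (\<Sum>i\<in>F. \<bar>a i\<bar>) + M * L2_set a F"
    (is "sum_norm ?w \<le> _")
    if F: "finite F" for F a
  proof (rule sum_norm_least)
    fix k
    have "partial_norm k ?w \<le> L2_set (\<lambda>n. q n ?w) ({..<p} \<union> {p..<k})"
      unfolding partial_norm_def by (intro L2_set_subset_mono) auto
    also have "\<dots> \<le> partial_norm p ?w + L2_set (\<lambda>n. q n ?w) {p..<k}"
      unfolding L2_set_def partial_norm_def
      by (subst sum.union_disjoint) (auto intro!: sqrt_add_le_add_sqrt sum_nonneg)
    also note C[of ?w]
    also have "L2_set (\<lambda>n. q n ?w) {p..<k} \<le> L2_set (\<lambda>n. \<Sum>i\<in>F. \<bar>a i\<bar> * q n (z (r i))) {p..<k}"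
      by (intro L2_set_mono seminorm_sum_scaleR_le seminorm_q q_nonneg)
    also have "\<dots> \<le> e * (\<Sum>i\<in>F. \<bar>a i\<bar>) + M * L2_set (\<lambda>i. \<bar>a i\<bar>) F"
      by (intro tail F) simp
    finally show "partial_norm k ?w \<le> C * norm ?w + e * (\<Sum>i\<in>F. \<bar>a i\<bar>) + M * L2_set a F"
      by (simp add: L2_set_abs)
  qed
  then have "l2_upper C e M (\<lambda>i. z (r i))" by (simp add: l2_upper_def)
  moreover have "0 < C" by (simp add: C_def)
  ultimately show thesis using that r by blast
qed

lemma block_average_l1_lower_norm:
  assumes \<xi>: "ord_wf \<xi>" "\<xi> \<noteq> OZero" and z: "l1_lower \<xi> sum_norm \<delta> z" and "0 < m" "0 < C"
    and upper: "l2_upper C (\<delta> / 4) M z"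
    and M: "0 \<le> M" "M / sqrt (real m) \<le> \<delta> / 4"
  shows "l1_lower \<xi> norm (\<delta> / (2 * C)) (block_average m z)"
  unfolding l1_lower_def
proof (intro ballI allI)
  fix F b assume F: "F \<in> schreier \<xi>"
  let ?u = "\<Sum>j\<in>F. b j *\<^sub>R block_average m z j" and ?G = "\<Union>j\<in>F. block m j"
  have "finite F" using schreier_finite[OF F] .
  note sums = sum_block_coeff[OF \<open>0 < m\<close> \<open>finite F\<close>] sum_abs_block_coeff[OF \<open>0 < m\<close> \<open>finite F\<close>]
    L2_set_block_coeff[OF \<open>0 < m\<close> \<open>finite F\<close>]
  have "\<delta> * (\<Sum>j\<in>F. \<bar>b j\<bar>) \<le> sum_norm ?u"
    by (rule l1_lowerD[OF l1_lower_block_average[OF \<xi> \<open>0 < m\<close> z] F])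
  also have "\<dots> \<le> C * norm ?u + \<delta> / 4 * (\<Sum>j\<in>F. \<bar>b j\<bar>) + M / sqrt (real m) * L2_set b F"
    using l2_upperD[OF upper, of ?G "block_coeff m b"] \<open>finite F\<close> by (simp add: sums)
  also have "M / sqrt (real m) * L2_set b F \<le> \<delta> / 4 * (\<Sum>j\<in>F. \<bar>b j\<bar>)"
  proof (intro mult_mono M(2) L2_set_le_sum_abs L2_set_nonneg)
    have "0 \<le> M / sqrt (real m)" using M(1) by simp
    then show "0 \<le> \<delta> / 4" using M(2) by linarith
  qed
  finally have "\<delta> * (\<Sum>j\<in>F. \<bar>b j\<bar>) \<le> C * norm ?u + 2 * (\<delta> / 4 * (\<Sum>j\<in>F. \<bar>b j\<bar>))" by simp
  then show "\<delta> / (2 * C) * (\<Sum>j\<in>F. \<bar>b j\<bar>) \<le> norm ?u"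
    using \<open>0 < C\<close> by (simp add: field_simps)
qed

text \<open>Averaging over long blocks makes the l2 part of the upper estimate negligible.\<close>

theorem sum_inclusion_fixes_l1_spreading_model:
  assumes \<xi>: "ord_wf \<xi>" "\<xi> \<noteq> OZero" and "l1_spreading_model \<xi> sum_sp z"
  obtains u where "l1_spreading_model \<xi> sum_sp u" "l1_spreading_model \<xi> type_sp u"
proof -
  obtain M \<delta> where z: "\<And>i. z i \<in> sum_space" "\<And>i. sum_norm (z i) \<le> M"
    and \<delta>: "0 < \<delta>" "l1_lower \<xi> sum_norm \<delta> z"
    using assms(3) unfolding l1_spreading_model_normed_subspace_iff by blast
  have M: "0 \<le> M" using sum_norm_nonneg[OF z(1)[of 0]] z(2)[of 0] by linarith
  obtain r :: "nat \<Rightarrow> nat" and C where r: "strict_mono r" and C: "0 < C"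
    and upper: "l2_upper C (\<delta> / 4) M (\<lambda>i. z (r i))"
    using bounded_subseq_l2_upper[of z M "\<delta> / 4", OF z] \<delta>(1) by auto
  obtain m where m: "0 < m" "M / sqrt (real m) < \<delta> / 4"
    using ex_div_sqrt_less[of "\<delta> / 4" M] \<delta>(1) by auto
  define u where "u = block_average m (\<lambda>i. z (r i))"
  have zr: "l1_lower \<xi> sum_norm \<delta> (\<lambda>i. z (r i))" by (rule l1_lower_strict_mono[OF r \<delta>(2)])
  have "u j \<in> {y \<in> sum_space. sum_norm y \<le> M}" for j
    unfolding u_def using z m(1) by (intro block_average_in_convex convex_sum_norm_ball) auto
  then have u: "u j \<in> sum_space" "sum_norm (u j) \<le> M" for j by auto
  have "l1_lower \<xi> sum_norm \<delta> u"
    unfolding u_def by (rule l1_lower_block_average[OF \<xi> m(1) zr])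
  then have "l1_spreading_model \<xi> sum_sp u"
    unfolding l1_spreading_model_normed_subspace_iff using u \<delta>(1) by blast
  moreover have "norm (u j) \<le> L * M" for j
    using norm_le_sum_norm[OF u(1)[of j]] mult_left_mono[OF u(2)[of j], of L] L_pos by linarith
  moreover have "l1_lower \<xi> norm (\<delta> / (2 * C)) u"
    unfolding u_def by (rule block_average_l1_lower_norm[OF \<xi> zr m(1) C upper M less_imp_le[OF m(2)]])
  moreover have "0 < \<delta> / (2 * C)" using \<delta>(1) C by simp
  ultimately show thesis using that unfolding l1_spreading_model_type_sp_iff by blast
qed

lemma sum_norm_small_average:
  assumes w: "\<And>i. w i \<in> sum_space" "\<And>i. sum_norm (w i) \<le> M" "w \<longlonglongrightarrow> 0" and "0 < e"
  obtains r :: "nat \<Rightarrow> nat" and F where "finite F" "F \<noteq> {}"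
    "sum_norm (\<Sum>i\<in>F. (1 / real (card F)) *\<^sub>R w (r i)) < e"
proof -
  obtain r :: "nat \<Rightarrow> nat" and C where r: "strict_mono r" and C: "0 < C"
    and upper: "l2_upper C (e / 3) M (\<lambda>i. w (r i))"
    using bounded_subseq_l2_upper[of w M "e / 3", OF w(1,2)] \<open>0 < e\<close> by auto
  obtain k where k: "0 < k" "M / sqrt (real k) < e / 3"
    using ex_div_sqrt_less[of "e / 3" M] \<open>0 < e\<close> by auto
  have "(\<lambda>i. norm (w (r i))) \<longlonglongrightarrow> 0"
    using LIMSEQ_subseq_LIMSEQ[OF w(3) r] by (simp add: comp_def tendsto_norm_zero)
  then have "eventually (\<lambda>i. norm (w (r i)) < e / (3 * C)) sequentially"
    using \<open>0 < e\<close> C by (intro order_tendstoD(2)[of _ 0]) auto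
  then obtain N where N: "\<And>i. N \<le> i \<Longrightarrow> norm (w (r i)) < e / (3 * C)"
    unfolding eventually_sequentially by blast
  define F where "F = {N..<N + k}"
  have F: "finite F" "card F = k" "F \<noteq> {}" using k(1) by (auto simp: F_def)
  let ?v = "\<Sum>i\<in>F. (1 / real k) *\<^sub>R w (r i)"
  have "?v \<in> cball 0 (e / (3 * C))"
    using N k(1) by (intro convex_sum convex_cball F(1)) (auto simp: F F_def less_imp_le)
  then have Cv: "C * norm ?v \<le> e / 3" using C by (simp add: field_simps)
  have "sum_norm ?v \<le> C * norm ?v + e / 3 * (\<Sum>i\<in>F. \<bar>1 / real k\<bar>) + M * L2_set (\<lambda>_. 1 / real k) F"
    by (rule l2_upperD[OF upper F(1)])
  also have "(\<Sum>i\<in>F. \<bar>1 / real k\<bar>) = 1" using k(1) by (simp add: F)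
  also have "L2_set (\<lambda>_. 1 / real k) F = 1 / sqrt (real k)"
    using k(1) by (simp add: L2_set_constant F real_div_sqrt field_simps)
  also have "C * norm ?v + e / 3 * 1 + M * (1 / sqrt (real k)) < e"
    using Cv k(2) unfolding times_divide_eq_right mult_1_right by linarith
  finally show thesis using that[of F r] F by simp
qed

lemma bounded_convex_closure_sum_norm_approachable:
  assumes S: "convex S" "S \<subseteq> {y \<in> sum_space. sum_norm y \<le> M}"
    and l: "l \<in> sum_space" "l \<in> closure S" and "0 < e"
  obtains s where "s \<in> S" "sum_norm (s - l) < e"
proof -
  obtain t where t: "\<And>i. t i \<in> S" "t \<longlonglongrightarrow> l" using l(2) unfolding closure_sequential by blast
  have tN: "t i \<in> sum_space" "sum_norm (t i) \<le> M" for i using t(1) S(2) by auto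
  have "sum_norm (t i - l) \<le> M + sum_norm l" for i
    using sum_norm_diff[OF tN(1) l(1), of i] tN(2)[of i] by linarith
  then obtain r :: "nat \<Rightarrow> nat" and F where F: "finite F" "F \<noteq> {}"
    and small: "sum_norm (\<Sum>i\<in>F. (1 / real (card F)) *\<^sub>R (t (r i) - l)) < e"
    using sum_norm_small_average[of "\<lambda>i. t i - l" "M + sum_norm l" e] tN(1) l(1) t(2) \<open>0 < e\<close>
    by (metis LIM_zero sum_space_diff)
  have card: "(\<Sum>i\<in>F. 1 / real (card F)) = 1" using F by simp
  have "(\<Sum>i\<in>F. (1 / real (card F)) *\<^sub>R (t (r i) - l)) = (\<Sum>i\<in>F. (1 / real (card F)) *\<^sub>R t (r i)) - l"
    unfolding scaleR_diff_right sum_subtractf scaleR_sum_left[symmetric] card by simp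
  moreover have "(\<Sum>i\<in>F. (1 / real (card F)) *\<^sub>R t (r i)) \<in> S"
    using F card t(1) S(1) by (intro convex_sum) auto
  ultimately show thesis using that small by simp
qed

lemma eventually_functional_less:
  assumes \<phi>: "operator sum_sp (type_sp :: real nspace) \<phi>" and l: "l \<in> sum_space"
    and f: "limitin (weak_top type_sp) f l F"
    and bound: "eventually (\<lambda>i. f i \<in> sum_space \<and> sum_norm (f i) \<le> M) F" and "0 < e"
  shows "eventually (\<lambda>i. \<phi> (f i) < \<phi> l + e) F"
proof (rule ccontr)
  assume "\<not> ?thesis"
  then have "frequently (\<lambda>i. \<phi> l + e \<le> \<phi> (f i)) F" by (simp add: frequently_def not_le)
  define T where "T = {y \<in> sum_space. sum_norm y \<le> M} \<inter> {y \<in> sum_space. \<phi> l + e \<le> \<phi> y}"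
  obtain K where K: "\<forall>x\<in>sum_space. \<bar>\<phi> x\<bar> \<le> K * sum_norm x"
    using \<phi> by (auto simp: operator_def)
  have T: "convex T"
    unfolding T_def
    by (intro convex_Int convex_sum_norm_ball convex_superlevel_operator[OF subspace_sum_space \<phi>])
  have "frequently (\<lambda>i. f i \<in> T) F"
    using frequently_eventually_conj[OF \<open>frequently _ F\<close> bound]
    by (rule frequently_elim1) (auto simp: T_def)
  then have "l \<in> closure T" by (rule Mazur[OF f _ T])
  moreover have "0 < e / (\<bar>K\<bar> + 1)" using \<open>0 < e\<close> by simp
  ultimately obtain s where s: "s \<in> T" "sum_norm (s - l) < e / (\<bar>K\<bar> + 1)"
    using bounded_convex_closure_sum_norm_approachable[OF T _ l, of M] unfolding T_def by blast
  have sl: "s - l \<in> sum_space" using s(1) l by (simp add: T_def sum_space_diff)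
  have "\<phi> (s - l) = \<phi> s - \<phi> l"
    using operator_normed_subspace_diff[OF subspace_sum_space \<phi>] s(1) l by (simp add: T_def)
  then have "e \<le> \<phi> (s - l)" using s(1) by (simp add: T_def)
  also have "\<dots> \<le> \<bar>\<phi> (s - l)\<bar>" by simp
  also have "\<dots> \<le> K * sum_norm (s - l)" using K sl by blast
  also have "\<dots> \<le> (\<bar>K\<bar> + 1) * sum_norm (s - l)" by (intro mult_right_mono sum_norm_nonneg sl) simp
  also have "\<dots> < e" using s(2) by (simp add: field_simps)
  finally show False by simp
qed

lemma bounded_weak_limit_in_sum:
  assumes "l \<in> sum_space" "limitin (weak_top type_sp) f l F"
    and "eventually (\<lambda>i. f i \<in> sum_space \<and> sum_norm (f i) \<le> M) F"
  shows "limitin (weak_top sum_sp) f l F"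
proof (rule limitin_weak_topI)
  fix \<phi> assume \<phi>: "operator sum_sp (type_sp :: real nspace) \<phi>"
  have "bounded_linear (uminus :: real \<Rightarrow> real)"
    by (rule bounded_linear_minus[OF bounded_linear_ident])
  then have "operator sum_sp (type_sp :: real nspace) (uminus \<circ> \<phi>)"
    by (intro operator_comp[OF \<phi> _ banach_sp_type_sp]) (simp add: operator_type_sp_iff)
  note neg = eventually_functional_less[OF this assms]
  show "((\<lambda>i. \<phi> (f i)) \<longlongrightarrow> \<phi> l) F"
  proof (rule tendstoI)
    fix e :: real assume "0 < e"
    show "eventually (\<lambda>i. dist (\<phi> (f i)) (\<phi> l) < e) F"
      using eventually_functional_less[OF \<phi> assms \<open>0 < e\<close>] neg[OF \<open>0 < e\<close>]
      by eventually_elim (auto simp: dist_real_def)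
  qed
qed (use assms in \<open>auto elim: eventually_mono\<close>)

theorem weakly_compact_op_sum_if_weak_limits:
  assumes lim: "\<And>F. ultrafilter F \<Longrightarrow> eventually (\<lambda>y. y \<in> sum_space \<and> sum_norm y \<le> 1) F \<Longrightarrow>
    \<exists>l. limitin (weak_top type_sp) (\<lambda>y. y) l F"
  shows "weakly_compact_op sum_sp sum_sp id"
proof -
  define S where "S = {y \<in> sum_space. sum_norm y \<le> 1}"
  have "compactin (weak_top sum_sp) S"
  proof (rule compactin_ultrafilterI)
    show "S \<subseteq> topspace (weak_top sum_sp)" by (auto simp: topspace_weak_top S_def)
    fix F assume F: "ultrafilter F" "eventually (\<lambda>y. y \<in> S) F"
    have bound: "eventually (\<lambda>y. y \<in> sum_space \<and> sum_norm y \<le> 1) F" using F(2) by (simp add: S_def)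
    then obtain l where l: "limitin (weak_top type_sp) (\<lambda>y. y) l F" using lim[OF F(1)] by blast
    have "l \<in> S"
      using weak_limit_sum_norm_le[OF ultrafilter_not_bot[OF F(1)] l bound] by (simp add: S_def)
    moreover have "limitin (weak_top sum_sp) (\<lambda>y. y) l F"
      by (rule bounded_weak_limit_in_sum[OF _ l bound]) (use \<open>l \<in> S\<close> in \<open>simp add: S_def\<close>)
    ultimately show "\<exists>l\<in>S. limitin (weak_top sum_sp) (\<lambda>y. y) l F" by blast
  qed
  moreover have "Hausdorff_space (weak_top sum_sp)"
    by (rule Hausdorff_weak_top_injective_operator[OF operator_sum_inclusion]) simp
  ultimately have "weak_top sum_sp closure_of S = S"
    by (simp add: closure_of_eq compactin_imp_closedin)
  with \<open>compactin (weak_top sum_sp) S\<close> show ?thesis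
    by (simp add: weakly_compact_op_def operator_id S_def)
qed

end

section \<open>The K-functional and the interpolation space of an operator\<close>

definition K_functional ::
  "('x::real_normed_vector \<Rightarrow> 'y::real_normed_vector) \<Rightarrow> real \<Rightarrow> 'y \<Rightarrow> real" where
  "K_functional A t y = (INF x. norm x / t + t * norm (y - A x))"

context
  fixes A :: "'x::real_normed_vector \<Rightarrow> 'y::real_normed_vector" and t :: real
  assumes A: "bounded_linear A" and t: "0 < t"
begin

lemma bdd_below_K_functional: "bdd_below (range (\<lambda>x. norm x / t + t * norm (y - A x)))"
  using t by (intro bdd_belowI2[of _ 0]) simp

lemma K_functional_le: "K_functional A t y \<le> norm x / t + t * norm (y - A x)"
  unfolding K_functional_def by (rule cINF_lower[OF bdd_below_K_functional UNIV_I])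

lemma le_K_functional: "(\<And>x. b \<le> norm x / t + t * norm (y - A x)) \<Longrightarrow> b \<le> K_functional A t y"
  unfolding K_functional_def by (rule cINF_greatest) auto

lemma seminorm_K_functional: "seminorm (K_functional A t)"
proof (rule sublinear_even_imp_seminorm)
  interpret A: bounded_linear A by (rule A)
  show "sublinear (K_functional A t)"
    unfolding K_functional_def[abs_def]
  proof (rule sublinear_INF[OF UNIV_not_empty bdd_below_K_functional])
    fix u v :: 'x and x y :: 'y
    have "norm (u + v) / t + t * norm (x + y - A (u + v))
        \<le> (norm u + norm v) / t + t * (norm (x - A u) + norm (y - A v))"
      using norm_triangle_ineq[of "x - A u" "y - A v"] t
      by (intro add_mono divide_right_mono mult_left_mono norm_triangle_ineq)
        (auto simp: A.add algebra_simps)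
    also have "\<dots> = (norm u / t + t * norm (x - A u)) + (norm v / t + t * norm (y - A v))"
      by (simp add: algebra_simps add_divide_distrib)
    finally show "\<exists>w\<in>UNIV. norm w / t + t * norm (x + y - A w) \<le> \<dots>" by blast
  next
    fix a :: real and u :: 'x and x :: 'y assume "0 < a"
    have "norm (a *\<^sub>R u) / t + t * norm (a *\<^sub>R x - A (a *\<^sub>R u))
        = a * (norm u / t + t * norm (x - A u))"
      unfolding A.scaleR scaleR_diff_right[symmetric] norm_scaleR
      using \<open>0 < a\<close> by (simp add: algebra_simps)
    then show "\<exists>w\<in>UNIV. norm w / t + t * norm (a *\<^sub>R x - A w)
        \<le> a * (norm u / t + t * norm (x - A u))"
      by (metis UNIV_I order_refl)
  qed
  have le: "K_functional A t (- y) \<le> K_functional A t y" for y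
  proof (rule le_K_functional)
    show "K_functional A t (- y) \<le> norm x / t + t * norm (y - A x)" for x
      using K_functional_le[of "- y" "- x"]
      by (simp add: linear_neg[OF A.linear_axioms] norm_minus_commute)
  qed
  show "K_functional A t (- y) = K_functional A t y" for y
    using le[of y] le[of "- y"] by simp
qed

lemma K_functional_le_norm: "K_functional A t y \<le> t * norm y"
  using K_functional_le[of y 0] by (simp add: linear_0[OF bounded_linear.linear[OF A]])

lemma K_functional_image_le: "K_functional A t (A x) \<le> norm x / t"
  using K_functional_le[of "A x" x] by simp

lemma norm_le_K_functional: "norm y \<le> max (t * onorm A) (1 / t) * K_functional A t y"
proof -
  define L where "L = max (t * onorm A) (1 / t)"
  have L: "t * onorm A \<le> L" "1 / t \<le> L" "0 < L" using t by (auto simp: L_def less_max_iff_disj)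
  have "norm y / L \<le> K_functional A t y"
  proof (rule le_K_functional)
    fix x
    have "norm y \<le> norm (A x) + norm (y - A x)" using norm_triangle_ineq[of "A x" "y - A x"] by simp
    also have "norm (A x) \<le> onorm A * norm x" by (rule onorm[OF A])
    also have "onorm A * norm x = (t * onorm A) * (norm x / t)" using t by simp
    also have "\<dots> \<le> L * (norm x / t)" using L(1) t by (intro mult_right_mono) auto
    also have "norm (y - A x) = (1 / t) * (t * norm (y - A x))" using t by simp
    also have "\<dots> \<le> L * (t * norm (y - A x))" using L(2) t by (intro mult_right_mono) auto
    finally show "norm y / L \<le> norm x / t + t * norm (y - A x)"
      using L(3) by (simp add: field_simps)
  qed
  then show ?thesis using L(3) by (simp add: L_def field_simps)
qed

lemma K_functional_lessD:
  assumes "K_functional A t y < b"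
  obtains x where "norm x \<le> b * t" "norm (y - A x) \<le> b / t"
proof -
  obtain x where x: "norm x / t + t * norm (y - A x) < b"
    using assms le_K_functional[of b y] by (meson leD leI)
  have "0 \<le> norm x / t" "0 \<le> t * norm (y - A x)" using t by auto
  then have "norm x / t \<le> b" "t * norm (y - A x) \<le> b" using x by linarith+
  then show thesis using that[of x] t by (simp add: field_simps)
qed

end

locale interpolation_space = bounded_linear A for A :: "'x::banach \<Rightarrow> 'y::banach"
begin

sublocale l2_sum_of_norms "\<lambda>n. K_functional A (2 ^ n)" "\<lambda>n. 2 ^ n" "max (onorm A) 1"
proof
  have A: "bounded_linear A" by unfold_locales
  show "seminorm (K_functional A (2 ^ n))" for n by (simp add: seminorm_K_functional A)
  show "K_functional A (2 ^ n) y \<le> 2 ^ n * norm y" for n y by (simp add: K_functional_le_norm A)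
  show "norm y \<le> max (onorm A) 1 * K_functional A (2 ^ 0) y" for y
    using norm_le_K_functional[OF A, of 1 y] by simp
qed simp

lemma operator_A: "operator type_sp type_sp A"
  unfolding operator_type_sp_iff by unfold_locales

lemma partial_norm_image_le: "partial_norm k (A x) \<le> 2 * norm x"
proof -
  have "partial_norm k (A x) \<le> (\<Sum>n<k. K_functional A (2 ^ n) (A x))"
    unfolding partial_norm_def by (intro L2_set_le_sum q_nonneg)
  also have "\<dots> \<le> (\<Sum>n<k. norm x / 2 ^ n)"
    using operator_A by (intro sum_mono K_functional_image_le) (simp_all add: operator_type_sp_iff)
  also have "\<dots> = norm x * (2 - 2 / 2 ^ k)" by (induction k) (auto simp: field_simps)
  also have "\<dots> \<le> norm x * 2" by (intro mult_left_mono) auto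
  finally show ?thesis by simp
qed

lemma operator_into_sum: "operator type_sp sum_sp A"
  unfolding operator_def
  using sum_spaceI[OF partial_norm_image_le] sum_norm_least[OF partial_norm_image_le]
  by (auto simp: add scale intro!: exI[of _ 2])

lemma almost_absorbs_sum_norm_ball: "almost_absorbs A {y \<in> sum_space. sum_norm y \<le> M}"
  unfolding almost_absorbs_def
proof (intro allI impI)
  fix \<eta> :: real assume "0 < \<eta>"
  obtain n where "(\<bar>M\<bar> + 1) / \<eta> < 2 ^ n" using real_arch_pow[of 2] by auto
  then have n: "(\<bar>M\<bar> + 1) / 2 ^ n \<le> \<eta>" using \<open>0 < \<eta>\<close> by (simp add: field_simps)
  have "\<exists>x. norm x \<le> (\<bar>M\<bar> + 1) * 2 ^ n \<and> norm (y - A x) \<le> \<eta>"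
    if "y \<in> sum_space" "sum_norm y \<le> M" for y
  proof -
    have "K_functional A (2 ^ n) y < \<bar>M\<bar> + 1"
      using q_le_sum_norm[OF that(1), of n] that(2) by linarith
    then obtain x where "norm x \<le> (\<bar>M\<bar> + 1) * 2 ^ n" "norm (y - A x) \<le> (\<bar>M\<bar> + 1) / 2 ^ n"
      using K_functional_lessD[of A "2 ^ n" y] operator_A by (auto simp: operator_type_sp_iff)
    then show ?thesis using n by (auto intro: order_trans)
  qed
  then show "\<exists>R. \<forall>y\<in>{y \<in> sum_space. sum_norm y \<le> M}. \<exists>x. norm x \<le> R \<and> norm (y - A x) \<le> \<eta>" by blast
qed

lemma SM1_sum_id:
  assumes \<xi>: "ord_wf \<xi>" "\<xi> \<noteq> OZero" and A: "SM1 \<xi> type_sp type_sp A"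
  shows "SM1 \<xi> sum_sp sum_sp id"
  unfolding SM1_id_iff
proof
  assume "\<exists>z. l1_spreading_model \<xi> sum_sp z"
  then obtain u where u: "l1_spreading_model \<xi> sum_sp u" "l1_spreading_model \<xi> type_sp u"
    using sum_inclusion_fixes_l1_spreading_model[OF \<xi>] by blast
  then obtain M where "range u \<subseteq> {y \<in> sum_space. sum_norm y \<le> M}"
    unfolding l1_spreading_model_normed_subspace_iff by blast
  then have "almost_absorbs A (range u)"
    by (rule almost_absorbs_subset[OF almost_absorbs_sum_norm_ball])
  then obtain x where "l1_spreading_model \<xi> type_sp x" "l1_spreading_model \<xi> type_sp (A \<circ> x)"
    by (rule almost_absorbs_l1_spreading_model[OF operator_A _ u(2)])
  then show False using A by (auto simp: SM1_def)
qed

lemma weakly_compact_op_sum_id: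
  assumes "weakly_compact_op type_sp type_sp A"
  shows "weakly_compact_op sum_sp sum_sp id"
proof (rule weakly_compact_op_sum_if_weak_limits)
  fix F assume "ultrafilter F" "eventually (\<lambda>y. y \<in> sum_space \<and> sum_norm y \<le> 1) F"
  then show "\<exists>l. limitin (weak_top type_sp) (\<lambda>y. y) l F"
    using almost_absorbs_ultrafilter_weak_limit[OF assms
        almost_absorbs_sum_norm_ball[of 1], of F "\<lambda>y. y"]
    by auto
qed

lemma ex_inj_on_sum_space:
  obtains f :: "'y \<Rightarrow> nat \<Rightarrow> 'x" where "inj_on f sum_space"
proof -
  obtain f :: "'y \<Rightarrow> nat \<Rightarrow> 'x" where f: "inj_on f (closure (range A))"
    by (rule ex_inj_on_closure_range)
  have "sum_space \<subseteq> closure (range A)"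
  proof
    fix y assume "y \<in> sum_space"
    then show "y \<in> closure (range A)"
      using almost_absorbs_subset_closure[OF almost_absorbs_sum_norm_ball[of "sum_norm y"]] by blast
  qed
  then show thesis using that inj_on_subset[OF f] by blast
qed

theorem factorization:
  obtains Z :: "(nat \<Rightarrow> 'x) nspace" and B C
  where "banach_sp Z" "operator type_sp Z C" "operator Z type_sp B" "A = B \<circ> C"
    "\<And>\<xi>. ord_wf \<xi> \<Longrightarrow> \<xi> \<noteq> OZero \<Longrightarrow> SM1 \<xi> type_sp type_sp A \<Longrightarrow> SM1 \<xi> Z Z id"
    "weakly_compact_op type_sp type_sp A \<Longrightarrow> weakly_compact_op Z Z id"
proof -
  obtain f :: "'y \<Rightarrow> nat \<Rightarrow> 'x" where inj: "inj_on f sum_space" by (rule ex_inj_on_sum_space)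
  then have f: "inj_on f (carrier sum_sp)" by simp
  define Z where "Z = transport f sum_sp"
  define B where "B = id \<circ> the_inv_into (carrier sum_sp) f"
  define C where "C = f \<circ> A"
  have "banach_sp Z" unfolding Z_def by (rule banach_sp_transport[OF f banach_sp_sum])
  moreover have "operator type_sp Z C"
    unfolding Z_def C_def
    by (rule operator_comp[OF operator_into_sum operator_transport[OF f] banach_sp_sum])
  moreover have "operator Z type_sp B"
    unfolding Z_def B_def
    by (rule operator_comp[OF operator_the_inv_into_transport[OF f banach_sp_sum]
          operator_sum_inclusion banach_sp_sum])
  moreover have "A = B \<circ> C"
    using operator_into_sum
    by (auto simp: B_def C_def fun_eq_iff operator_def the_inv_into_f_f[OF inj])
  moreover have "SM1 \<xi> Z Z id" if "ord_wf \<xi>" "\<xi> \<noteq> OZero" "SM1 \<xi> type_sp type_sp A" for \<xi>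
    unfolding Z_def by (rule SM1_transport_id[OF f banach_sp_sum SM1_sum_id[OF that]])
  moreover have "weakly_compact_op Z Z id" if "weakly_compact_op type_sp type_sp A"
    unfolding Z_def
    by (rule weakly_compact_op_transport_id[OF f banach_sp_sum weakly_compact_op_sum_id[OF that]])
  ultimately show thesis using that by blast
qed

end

theorem theoremA:
  fixes \<xi> :: ordn and A :: "'x::banach \<Rightarrow> 'y::banach"
  assumes "ord_wf \<xi>" and "\<xi> \<noteq> OZero"
  shows "(SM1 \<xi> (type_sp :: 'x nspace) (type_sp :: 'y nspace) A \<longrightarrow>
           (\<exists>Z :: (nat \<Rightarrow> 'x) nspace. \<exists>B C.
              banach_sp Z \<and> SM1 \<xi> Z Z id \<and>
              operator (type_sp :: 'x nspace) Z C \<and> operator Z (type_sp :: 'y nspace) B \<and>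
              A = B \<circ> C))
       \<and> (WC \<xi> (type_sp :: 'x nspace) (type_sp :: 'y nspace) A \<longrightarrow>
           (\<exists>Z :: (nat \<Rightarrow> 'x) nspace. \<exists>B C.
              banach_sp Z \<and> WC \<xi> Z Z id \<and>
              operator (type_sp :: 'x nspace) Z C \<and> operator Z (type_sp :: 'y nspace) B \<and>
              A = B \<circ> C))"
proof (cases "bounded_linear A")
  case True
  then interpret interpolation_space A by (rule interpolation_space.intro)
  obtain Z :: "(nat \<Rightarrow> 'x) nspace" and B C
    where "banach_sp Z" "operator type_sp Z C" "operator Z type_sp B" "A = B \<circ> C"
      "SM1 \<xi> type_sp type_sp A \<Longrightarrow> SM1 \<xi> Z Z id"
      "weakly_compact_op type_sp type_sp A \<Longrightarrow> weakly_compact_op Z Z id"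
    using factorization assms by metis
  then show ?thesis unfolding WC_def by blast
next
  case False
  then show ?thesis by (simp add: SM1_def WC_def operator_type_sp_iff)
qed

end
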